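(* Let $\mathbb{F}$ be a field, let $X$ and $Y$ be $n\times n$ matrices of variables, and let $r\le n$. Let $\mathcal{E}\subseteq\mathbb{F}^{r\times n}$ be a weak $(r,r(n-r))$-lossless rank condenser with $|\mathcal{E}|\ge 2r(n-r)+1$. Let $t:\mathbb{N}\times\mathbb{N}\to\mathbb{N}$ be a function such that: if $\mathrm{char}(\mathbb{F})=0$, any product-depth $\Delta$ circuit computing $\det_n(X)+O(\varepsilon)$ has size at least $t(n,\Delta)$; and if $\mathrm{char}(\mathbb{F})=p>0$, any product-depth $\Delta$ circuit computing $\det_n(X)^{p^k}+O(\varepsilon)$ for any $k\in\mathbb{N}$ has size at least $t(n,\Delta)$. Let $C(X,Y,\vec z,W,U,V)$ be an IPS refutation of the system \[ \det_r(EXE^\top)=0\ \ (\forall E\in\mathcal{E}),\quad XY-I_n=0,\quad X\odot X-X=0,\quad Y\odot Y-Y=0, \] where $\vec z$ are placeholder variables for the first set of equations and $W,U,V$ are $n\times n$ matrices of placeholder variables for the second, third, and fourth sets of equations respectively. Then any product-depth $\Delta$ circuit computing $C(X,Y,\vec z,W,U,V)+O(\varepsilon)$ must have size $t(\Omega(r^{1/3}),\Delta+1)-O(n^4)$.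
   Context: A set $\mathcal{E}\subseteq\mathbb{F}^{r\times n}$ is a weak $(r,L)$-lossless rank condenser if for every $A\in\mathbb{F}^{n\times r}$ of rank $r$, $|\{E\in\mathcal{E}:\mathrm{rank}(EA)<r\}|\le L$. $I_n$ is the identity matrix, $\odot$ the entrywise (Hadamard) product. An IPS refutation of a system $f_1=\dots=f_k=0$ of polynomials in $\vec x$ is a polynomial $C(\vec x,y_1,\dots,y_k)$ with $C(\vec x,\vec 0)=0$ and $C(\vec x,f_1(\vec x),\dots,f_k(\vec x))=1$. $\varepsilon$ is an indeterminate; a circuit computing $f+O(\varepsilon)$ is a circuit with constants from $\mathbb{F}((\varepsilon))$ computing $f+\varepsilon g$ with $g\in\mathbb{F}[[\varepsilon]][\text{variables}]$. Product-depth is the maximum number of multiplication gates on an input-to-output path. *)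

theory Defs
  imports
    "HOL-Library.Poly_Mapping"
    "HOL-Library.Landau_Symbols"
    "HOL-Computational_Algebra.Formal_Laurent_Series"
    "Jordan_Normal_Form.DL_Rank"
begin

section \<open>Multivariate polynomials\<close>

text \<open>Polynomials are finitely supported maps from monomials to coefficients; the ring
  structure is the convolution product of \<^theory>\<open>HOL-Library.Poly_Mapping\<close>.\<close>

type_synonym ('v, 'c) mpoly = "('v \<Rightarrow>\<^sub>0 nat) \<Rightarrow>\<^sub>0 'c"

definition Var :: "'v \<Rightarrow> ('v, 'c::comm_ring_1) mpoly" where
  "Var v = Poly_Mapping.single (Poly_Mapping.single v 1) 1"

definition Const :: "'c \<Rightarrow> ('v, 'c::comm_ring_1) mpoly" where
  "Const c = Poly_Mapping.single 0 c"

definition mpoly_vars :: "('v, 'c::zero) mpoly \<Rightarrow> 'v set" where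
  "mpoly_vars p = (\<Union>m\<in>Poly_Mapping.keys p. Poly_Mapping.keys m)"

definition mpoly_subst ::
  "('v \<Rightarrow> ('w, 'c::comm_ring_1) mpoly) \<Rightarrow> ('v, 'c) mpoly \<Rightarrow> ('w, 'c) mpoly" where
  "mpoly_subst s p = (\<Sum>m\<in>Poly_Mapping.keys p.
     Const (Poly_Mapping.lookup p m) *
     (\<Prod>v\<in>Poly_Mapping.keys m. s v ^ Poly_Mapping.lookup m v))"


section \<open>Algebraic circuits\<close>

text \<open>A circuit is a directed acyclic graph given in topological order: gate \<open>i\<close> of the list
  may only refer to gates with smaller index, and the last gate is the output. Fan-in is unbounded.
  A wire into an addition gate carries a scalar, so that an addition gate computes a linear
  combination of its inputs; a gate may occur several times among the inputs of another gate.
  Empty sums and products are allowed and denote 0 and 1. The size is the number of wires.\<close>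

datatype ('v, 'c) gate =
    InVar 'v
  | InConst 'c
  | Add "('c \<times> nat) list"
  | Mult "nat list"

type_synonym ('v, 'c) circuit = "('v, 'c) gate list"

fun children :: "('v, 'c) gate \<Rightarrow> nat list" where
  "children (InVar v) = []"
| "children (InConst c) = []"
| "children (Add ws) = map snd ws"
| "children (Mult is) = is"

definition circuit_on :: "'v set \<Rightarrow> ('v, 'c) circuit \<Rightarrow> bool" where
  "circuit_on V \<Phi> \<longleftrightarrow> \<Phi> \<noteq> [] \<and>
     (\<forall>i<length \<Phi>. (\<forall>j\<in>set (children (\<Phi> ! i)). j < i) \<and> (\<forall>v. \<Phi> ! i = InVar v \<longrightarrow> v \<in> V))"

definition circuit_size :: "('v, 'c) circuit \<Rightarrow> nat" where
  "circuit_size \<Phi> = (\<Sum>G\<leftarrow>\<Phi>. length (children G))"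

text \<open>In \<open>gate_poly\<close> and \<open>gate_pdepth\<close> the list argument holds the results for all preceding gates.\<close>

fun gate_poly ::
  "('v, 'c::comm_ring_1) mpoly list \<Rightarrow> ('v, 'c) gate \<Rightarrow> ('v, 'c) mpoly" where
  "gate_poly ps (InVar v) = Var v"
| "gate_poly ps (InConst c) = Const c"
| "gate_poly ps (Add ws) = (\<Sum>(c, i)\<leftarrow>ws. Const c * ps ! i)"
| "gate_poly ps (Mult is) = (\<Prod>i\<leftarrow>is. ps ! i)"

fun gate_pdepth :: "nat list \<Rightarrow> ('v, 'c) gate \<Rightarrow> nat" where
  "gate_pdepth ds (InVar v) = 0"
| "gate_pdepth ds (InConst c) = 0"
| "gate_pdepth ds (Add ws) = Max (insert 0 ((\<lambda>(c, i). ds ! i) ` set ws))"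
| "gate_pdepth ds (Mult is) = Suc (Max (insert 0 ((\<lambda>i. ds ! i) ` set is)))"

definition circuit_poly :: "('v, 'c::comm_ring_1) circuit \<Rightarrow> ('v, 'c) mpoly" where
  "circuit_poly \<Phi> = last (foldl (\<lambda>ps G. ps @ [gate_poly ps G]) [] \<Phi>)"

definition product_depth :: "('v, 'c) circuit \<Rightarrow> nat" where
  "product_depth \<Phi> = last (foldl (\<lambda>ds G. ds @ [gate_pdepth ds G]) [] \<Phi>)"

text \<open>\<open>\<Phi>\<close> computes \<open>f + O(\<epsilon>)\<close>: the indeterminate \<open>\<epsilon>\<close> is \<^const>\<open>fls_X\<close>, and \<open>\<Phi>\<close> has
  constants in the Laurent series field.\<close>

definition computes_approx ::
  "('v, 'a::field fls) circuit \<Rightarrow> ('v, 'a) mpoly \<Rightarrow> bool" where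
  "computes_approx \<Phi> f \<longleftrightarrow> (\<exists>g :: ('v, 'a fps) mpoly.
     circuit_poly \<Phi> = Poly_Mapping.map fls_const f + Const fls_X * Poly_Mapping.map fps_to_fls g)"


section \<open>Lossless rank condensers\<close>

text \<open>\<^term>\<open>vec_space.rank m B\<close> is the rank of a matrix \<open>B\<close> with \<open>m\<close> rows. Finiteness of the set of
  bad \<open>E\<close> is required explicitly because \<^const>\<open>card\<close> is 0 on infinite sets.\<close>

definition weak_lossless_rank_condenser ::
  "nat \<Rightarrow> nat \<Rightarrow> nat \<Rightarrow> 'a::field mat set \<Rightarrow> bool" where
  "weak_lossless_rank_condenser n r L \<E> \<longleftrightarrow> \<E> \<subseteq> carrier_mat r n \<and>
     (\<forall>A\<in>carrier_mat n r. vec_space.rank n A = r \<longrightarrow>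
        finite {E\<in>\<E>. vec_space.rank r (E * A) < r} \<and>
        card {E\<in>\<E>. vec_space.rank r (E * A) < r} \<le> L)"


section \<open>IPS refutations\<close>

text \<open>The system consists of the polynomials \<open>f i\<close> for \<open>i\<close> in the finite set \<open>I\<close>, in the variables
  \<open>V\<close>. In the refutation, \<open>Inl v\<close> stands for the variable \<open>v\<close> and \<open>Inr i\<close> for the placeholder
  variable of the equation \<open>f i = 0\<close>.\<close>

definition ips_vars :: "'v set \<Rightarrow> 'i set \<Rightarrow> ('v + 'i) set" where
  "ips_vars V I = Inl ` V \<union> Inr ` I"

definition ips_refutation ::
  "'v set \<Rightarrow> 'i set \<Rightarrow> ('i \<Rightarrow> ('v, 'a::field) mpoly) \<Rightarrow> ('v + 'i, 'a) mpoly \<Rightarrow> bool" where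
  "ips_refutation V I f C \<longleftrightarrow> finite I \<and> mpoly_vars C \<subseteq> ips_vars V I \<and>
     mpoly_subst (case_sum Var (\<lambda>_. 0)) C = 0 \<and>
     mpoly_subst (case_sum Var f) C = 1"


section \<open>The system of equations\<close>

datatype xy_var = X nat nat | Y nat nat

definition X_vars :: "nat \<Rightarrow> xy_var set" where
  "X_vars n = (\<lambda>(i, j). X i j) ` ({..<n} \<times> {..<n})"

definition Y_vars :: "nat \<Rightarrow> xy_var set" where
  "Y_vars n = (\<lambda>(i, j). Y i j) ` ({..<n} \<times> {..<n})"

definition X_mat :: "nat \<Rightarrow> (xy_var, 'a::comm_ring_1) mpoly mat" where
  "X_mat n = mat n n (\<lambda>(i, j). Var (X i j))"

definition Y_mat :: "nat \<Rightarrow> (xy_var, 'a::comm_ring_1) mpoly mat" where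
  "Y_mat n = mat n n (\<lambda>(i, j). Var (Y i j))"

definition hadamard :: "'b::times mat \<Rightarrow> 'b mat \<Rightarrow> 'b mat" where
  "hadamard A B = mat (dim_row A) (dim_col A) (\<lambda>(i, j). A $$ (i, j) * B $$ (i, j))"

text \<open>Equations, and at the same time placeholders: \<open>Z E\<close> for \<open>E \<in> \<E>\<close>, and \<open>W i j\<close>, \<open>U i j\<close>, \<open>V i j\<close>
  for the entries of the three matrix equations.\<close>

datatype 'a eqn = Z "'a mat" | W nat nat | U nat nat | V nat nat

definition sys_eqns :: "nat \<Rightarrow> 'a mat set \<Rightarrow> 'a eqn set" where
  "sys_eqns n \<E> = Z ` \<E> \<union>
     (\<Union>i<n. \<Union>j<n. {W i j, U i j, V i j})"

fun sys_poly :: "nat \<Rightarrow> 'a::field eqn \<Rightarrow> (xy_var, 'a) mpoly" where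
  "sys_poly n (Z E) = det (map_mat Const E * X_mat n * transpose_mat (map_mat Const E))"
| "sys_poly n (W i j) = (X_mat n * Y_mat n - 1\<^sub>m n) $$ (i, j)"
| "sys_poly n (U i j) = (hadamard (X_mat n) (X_mat n) - X_mat n) $$ (i, j)"
| "sys_poly n (V i j) = (hadamard (Y_mat n) (Y_mat n) - Y_mat n) $$ (i, j)"

end

theory Submission
  imports Defs "Jordan_Normal_Form.Char_Poly"
begin

text \<open>Let \<open>f(M) = 1 - C(M, I, 0, M - I, M \<odot> M - M, 0)\<close>. Then \<open>f(I) = 1\<close>, because \<open>C\<close> vanishes when all
  placeholders do, and \<open>f(M) = 0\<close> whenever \<open>M\<close> has rank less than \<open>r\<close>, because then every
  \<open>det(E M E\<^sup>T)\<close> is 0 and \<open>C\<close> is evaluated at the values of the equations. So there is an \<open>s \<ge> r - 1\<close>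
  such that \<open>f(P diag(1,\<dots>,1,x,0,\<dots>,0) Q)\<close>, with \<open>s\<close> ones and generic \<open>P\<close>, \<open>Q\<close>, vanishes at \<open>x = 0\<close>
  but not identically; let \<open>h(P, Q) x\<^sup>k\<close> be its term of lowest degree in \<open>x\<close>.
  The determinant of a \<open>t \<times> t\<close> matrix has an algebraic branching program with \<open>O(t\<^sup>3)\<close> nodes, hence
  is a Schur complement of a bordered unitriangular matrix of size \<open>O(t\<^sup>3)\<close> with affine entries.
  Scaled by powers of \<open>\<epsilon>\<close>, this matrix is \<open>L diag(1,\<dots>,1,x,0,\<dots>,0) R\<close> with \<open>L\<close>, \<open>R\<close>
  close to the identity and \<open>x = \<epsilon>\<^sup>a (1 + \<epsilon> det)\<close>, so between fixed \<open>P\<close> and \<open>Q\<close> the value of \<open>f\<close> is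
  \<open>h(P, Q) \<epsilon>\<^sup>a\<^sup>k (1 + \<epsilon> det)\<^sup>k\<close> up to higher order. The first nonconstant term of
  \<open>(1 + \<epsilon> det)\<^sup>k\<close> is a nonzero multiple of \<open>(\<epsilon> det)\<^sup>q\<close>, where \<open>q\<close> is the largest power of the
  characteristic dividing \<open>k\<close>. In the given circuit \<open>\<epsilon>\<close> is replaced by a high power of \<open>\<epsilon>\<close>, so that
  its own error does not interfere.\<close>

section \<open>Evaluation of multivariate polynomials\<close>

definition mono_eval :: "('v \<Rightarrow> 'r) \<Rightarrow> ('v \<Rightarrow>\<^sub>0 nat) \<Rightarrow> 'r::comm_ring_1" where
  "mono_eval s m = (\<Prod>v\<in>Poly_Mapping.keys m. s v ^ Poly_Mapping.lookup m v)"

text \<open>Coefficients and variables are mapped separately, so that substitution, change of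
  coefficients and evaluation at a point are all instances.\<close>

definition peval :: "('c::comm_ring_1 \<Rightarrow> 'r::comm_ring_1) \<Rightarrow> ('v \<Rightarrow> 'r) \<Rightarrow> ('v, 'c) mpoly \<Rightarrow> 'r" where
  "peval \<phi> s p = (\<Sum>m\<in>Poly_Mapping.keys p. \<phi> (Poly_Mapping.lookup p m) * mono_eval s m)"

lemma mpoly_subst_eq_peval: "mpoly_subst s = peval Const s"
  by (simp add: fun_eq_iff mpoly_subst_def peval_def mono_eval_def)

lemma mono_eval_superset:
  assumes "finite A" "Poly_Mapping.keys m \<subseteq> A"
  shows "mono_eval s m = (\<Prod>v\<in>A. s v ^ Poly_Mapping.lookup m v)"
  unfolding mono_eval_def
  by (rule prod.mono_neutral_left) (use assms in \<open>auto simp: in_keys_iff\<close>)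

lemma mono_eval_0 [simp]: "mono_eval s 0 = 1"
  by (simp add: mono_eval_def)

lemma mono_eval_add: "mono_eval s (m + m') = mono_eval s m * mono_eval s m'"
proof -
  let ?A = "Poly_Mapping.keys m \<union> Poly_Mapping.keys m'"
  have "mono_eval s (m + m') = (\<Prod>v\<in>?A. s v ^ Poly_Mapping.lookup (m + m') v)"
    by (rule mono_eval_superset) (auto simp: keys_add)
  also have "\<dots> = (\<Prod>v\<in>?A. s v ^ Poly_Mapping.lookup m v) * (\<Prod>v\<in>?A. s v ^ Poly_Mapping.lookup m' v)"
    by (simp add: lookup_add power_add prod.distrib)
  also have "\<dots> = mono_eval s m * mono_eval s m'"
    by (simp add: mono_eval_superset[of ?A])
  finally show ?thesis .
qed

lemma mono_eval_single [simp]: "mono_eval s (Poly_Mapping.single v k) = s v ^ k"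
  by (cases "k = 0") (auto simp: mono_eval_def)

lemma mono_eval_cong:
  assumes "\<And>v. v \<in> Poly_Mapping.keys m \<Longrightarrow> s v = s' v"
  shows "mono_eval s m = mono_eval s' m"
  unfolding mono_eval_def by (rule prod.cong) (auto simp: assms)

context comm_ring_hom
begin

lemma peval_superset:
  assumes "finite A" "Poly_Mapping.keys p \<subseteq> A"
  shows "peval hom s p = (\<Sum>m\<in>A. hom (Poly_Mapping.lookup p m) * mono_eval s m)"
  unfolding peval_def
  by (rule sum.mono_neutral_left) (use assms in \<open>auto simp: in_keys_iff\<close>)

lemma peval_0 [simp]: "peval hom s 0 = 0"
  by (simp add: peval_def)

lemma peval_single [simp]: "peval hom s (Poly_Mapping.single m c) = hom c * mono_eval s m"
  by (cases "c = 0") (auto simp: peval_def)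

lemma peval_add: "peval hom s (p + q) = peval hom s p + peval hom s q"
proof -
  let ?A = "Poly_Mapping.keys p \<union> Poly_Mapping.keys q"
  have "peval hom s (p + q) = (\<Sum>m\<in>?A. hom (Poly_Mapping.lookup (p + q) m) * mono_eval s m)"
    by (rule peval_superset) (auto simp: keys_add)
  also have "\<dots> = peval hom s p + peval hom s q"
    by (simp add: peval_superset[of ?A] lookup_add hom_add distrib_right sum.distrib)
  finally show ?thesis .
qed

lemma peval_sum: "peval hom s (\<Sum>i\<in>I. f i) = (\<Sum>i\<in>I. peval hom s (f i))"
  by (induction I rule: infinite_finite_induct) (auto simp: peval_add)

end

lemma mpoly_sum_monomials:
  fixes p :: "'a \<Rightarrow>\<^sub>0 'c::comm_monoid_add"
  shows "p = (\<Sum>m\<in>Poly_Mapping.keys p. Poly_Mapping.single m (Poly_Mapping.lookup p m))"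
proof (rule poly_mapping_eqI)
  fix k
  have "(\<Sum>m\<in>Poly_Mapping.keys p. Poly_Mapping.lookup (Poly_Mapping.single m (Poly_Mapping.lookup p m)) k)
      = (\<Sum>m\<in>Poly_Mapping.keys p. if m = k then Poly_Mapping.lookup p m else 0)"
    by (intro sum.cong) (auto simp: lookup_single when_def)
  also have "\<dots> = Poly_Mapping.lookup p k"
    by (simp add: sum.delta in_keys_iff)
  finally show "Poly_Mapping.lookup p k = Poly_Mapping.lookup (\<Sum>m\<in>Poly_Mapping.keys p. Poly_Mapping.single m (Poly_Mapping.lookup p m)) k"
    by (simp add: lookup_sum)
qed

context comm_ring_hom
begin

lemma peval_mult: "peval hom s (p * q) = peval hom s p * peval hom s q"
proof -
  have "peval hom s (p * q) = peval hom s
     ((\<Sum>m\<in>Poly_Mapping.keys p. Poly_Mapping.single m (Poly_Mapping.lookup p m)) *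
      (\<Sum>m\<in>Poly_Mapping.keys q. Poly_Mapping.single m (Poly_Mapping.lookup q m)))"
    using mpoly_sum_monomials[of p] mpoly_sum_monomials[of q] by simp
  also have "\<dots> = (\<Sum>m\<in>Poly_Mapping.keys p. \<Sum>m'\<in>Poly_Mapping.keys q.
      (hom (Poly_Mapping.lookup p m) * mono_eval s m) * (hom (Poly_Mapping.lookup q m') * mono_eval s m'))"
    by (simp add: sum_product peval_sum mult_single hom_mult mono_eval_add mult_ac)
  also have "\<dots> = peval hom s p * peval hom s q"
    by (simp add: peval_def sum_product)
  finally show ?thesis .
qed

lemma peval_1 [simp]: "peval hom s 1 = 1"
  using peval_single[of s 0 1] by simp

lemma peval_Var [simp]: "peval hom s (Var v) = s v"
  by (simp add: Var_def)

lemma peval_Const [simp]: "peval hom s (Const c) = hom c"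
  by (simp add: Const_def)

lemma comm_ring_hom_peval: "comm_ring_hom (peval hom s)"
  by unfold_locales (auto simp: peval_add peval_mult)

end

lemma comm_ring_hom_Const: "comm_ring_hom (Const :: 'c \<Rightarrow> ('v, 'c::comm_ring_1) mpoly)"
  by unfold_locales (auto simp: Const_def single_add mult_single)

lemma peval_cong:
  assumes "\<And>v. v \<in> mpoly_vars p \<Longrightarrow> s v = s' v"
  shows "peval \<phi> s p = peval \<phi> s' p"
  unfolding peval_def
proof (rule sum.cong)
  fix m assume "m \<in> Poly_Mapping.keys p"
  then have "mono_eval s m = mono_eval s' m"
    by (intro mono_eval_cong assms) (auto simp: mpoly_vars_def)
  then show "\<phi> (Poly_Mapping.lookup p m) * mono_eval s m = \<phi> (Poly_Mapping.lookup p m) * mono_eval s' m"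
    by simp
qed simp

lemma peval_hom:
  assumes "comm_ring_hom \<psi>"
  shows "\<psi> (peval \<phi> s p) = peval (\<lambda>c. \<psi> (\<phi> c)) (\<lambda>v. \<psi> (s v)) p"
proof -
  interpret comm_ring_hom \<psi> by fact
  show ?thesis
    by (simp add: peval_def mono_eval_def hom_sum hom_mult hom_prod hom_power)
qed

lemma peval_mpoly_subst:
  assumes "comm_ring_hom \<phi>"
  shows "peval \<phi> a (mpoly_subst s p) = peval \<phi> (\<lambda>v. peval \<phi> a (s v)) p"
proof -
  interpret comm_ring_hom \<phi> by fact
  show ?thesis
    unfolding mpoly_subst_eq_peval
    by (subst peval_hom[of "peval \<phi> a"]) (simp_all add: comm_ring_hom_peval)
qed

section \<open>Change of coefficients\<close>

lemma lookup_pm_map: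
  assumes "f 0 = 0"
  shows "Poly_Mapping.lookup (Poly_Mapping.map f p) k = f (Poly_Mapping.lookup p k)"
  using assms by transfer (auto simp: when_def)

text \<open>A monomial evaluated at \<open>Var\<close> is itself, so the coefficientwise map is an
  evaluation and inherits its compatibility with ring operations and composition from
  \<open>peval\<close>.\<close>

lemma pm_map_eq_peval:
  assumes "comm_ring_hom \<phi>"
  shows "Poly_Mapping.map \<phi> p = peval (\<lambda>c. Const (\<phi> c)) Var p"
proof -
  interpret comm_ring_hom \<phi> by fact
  have *: "mono_eval Var m = Poly_Mapping.single m (1::'b)" for m :: "'c \<Rightarrow>\<^sub>0 nat"
  proof -
    have "mono_eval Var m = (\<Prod>v\<in>Poly_Mapping.keys m. Poly_Mapping.single (Poly_Mapping.single v (Poly_Mapping.lookup m v)) (1::'b))"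
    proof -
      have "(Var v :: ('c,'b) mpoly) ^ k = Poly_Mapping.single (Poly_Mapping.single v k) 1" for v k
        by (induction k) (auto simp: Var_def mult_single simp flip: single_add)
      then show ?thesis by (simp add: mono_eval_def)
    qed
    also have "\<dots> = Poly_Mapping.single (\<Sum>v\<in>Poly_Mapping.keys m. Poly_Mapping.single v (Poly_Mapping.lookup m v)) 1"
    proof -
      have "finite A \<Longrightarrow> (\<Prod>v\<in>A. Poly_Mapping.single (f v) (1::'b)) = Poly_Mapping.single (\<Sum>v\<in>A. f v) 1" for A :: "'c set" and f :: "'c \<Rightarrow> 'c \<Rightarrow>\<^sub>0 nat"
        by (induction A rule: finite_induct) (auto simp: mult_single)
      then show ?thesis by simp
    qed
    finally show ?thesis using mpoly_sum_monomials[of m] by simp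
  qed
  show ?thesis
  proof (rule poly_mapping_eqI)
    fix k
    have "Poly_Mapping.lookup (peval (\<lambda>c. Const (\<phi> c)) Var p) k =
      (\<Sum>m\<in>Poly_Mapping.keys p. Poly_Mapping.lookup (Poly_Mapping.single m (\<phi> (Poly_Mapping.lookup p m))) k)"
      by (simp add: peval_def * Const_def mult_single lookup_sum)
    also have "\<dots> = (\<Sum>m\<in>Poly_Mapping.keys p. if m = k then \<phi> (Poly_Mapping.lookup p m) else 0)"
      by (intro sum.cong) (auto simp: lookup_single when_def)
    also have "\<dots> = \<phi> (Poly_Mapping.lookup p k)"
      by (auto simp: sum.delta in_keys_iff)
    finally show "Poly_Mapping.lookup (Poly_Mapping.map \<phi> p) k = Poly_Mapping.lookup (peval (\<lambda>c. Const (\<phi> c)) Var p) k"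
      by (simp add: lookup_pm_map)
  qed
qed

lemma comm_ring_hom_compose:
  assumes "comm_ring_hom \<phi>" "comm_ring_hom \<psi>"
  shows "comm_ring_hom (\<lambda>x. \<psi> (\<phi> x))"
proof -
  interpret a: comm_ring_hom \<phi> by fact
  interpret b: comm_ring_hom \<psi> by fact
  show ?thesis by unfold_locales (auto simp: a.hom_add a.hom_mult b.hom_add b.hom_mult)
qed

lemma comm_ring_hom_pm_map:
  assumes "comm_ring_hom \<phi>"
  shows "comm_ring_hom (Poly_Mapping.map \<phi> :: ('v, _) mpoly \<Rightarrow> _)"
proof -
  interpret comm_ring_hom "\<lambda>c. Const (\<phi> c) :: ('v, _) mpoly"
    by (rule comm_ring_hom_compose[OF assms comm_ring_hom_Const])
  show ?thesis using comm_ring_hom_peval[of Var] by (simp add: pm_map_eq_peval[OF assms, abs_def])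
qed

section \<open>Nonvanishing at powers of one indeterminate\<close>

text \<open>Kronecker substitution: each new weight exceeds all weighted sums formed so far, so
  division by it recovers the new exponent as quotient and the old sum as remainder.\<close>

lemma separating_weights:
  assumes "finite A" "finite M"
    and "\<And>m m'. m \<in> M \<Longrightarrow> m' \<in> M \<Longrightarrow> (\<And>v. v \<in> A \<Longrightarrow> m v = (m' v :: nat)) \<Longrightarrow> m = m'"
  shows "\<exists>w :: 'v \<Rightarrow> nat. inj_on (\<lambda>m. \<Sum>v\<in>A. w v * m v) M"
  using assms
proof -
  \<comment> \<open>The induction concerns agreement on the variables treated so far, because the
    third assumption refers to the whole of \<open>A\<close> and does not pass to subsets.\<close>
  have "\<exists>w :: 'v \<Rightarrow> nat. \<forall>m\<in>M. \<forall>m'\<in>M. (\<Sum>v\<in>A. w v * m v) = (\<Sum>v\<in>A. w v * m' v) \<longrightarrow> (\<forall>v\<in>A. m v = m' v)"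
    using assms(1)
  proof (induction A rule: finite_induct)
    case empty
    show ?case by simp
  next
    case (insert a A)
    then obtain w :: "'v \<Rightarrow> nat" where w: "\<forall>m\<in>M. \<forall>m'\<in>M. (\<Sum>v\<in>A. w v * m v) = (\<Sum>v\<in>A. w v * m' v) \<longrightarrow> (\<forall>v\<in>A. m v = m' v)"
      by blast
    define S where "S m = (\<Sum>v\<in>A. w v * m v)" for m
    define N where "N = Suc (Max (insert 0 (S ` M)))"
    have SN: "S m < N" if "m \<in> M" for m
      unfolding N_def less_Suc_eq_le by (rule Max_ge) (use that assms(2) in auto)
    have eq: "(\<Sum>v\<in>insert a A. (w(a := N)) v * m v) = N * m a + S m" for m
    proof -
      have "(\<Sum>v\<in>A. (w(a := N)) v * m v) = S m"
        unfolding S_def by (rule sum.cong) (use insert.hyps in auto)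
      then show ?thesis using insert.hyps by simp
    qed
    have "\<forall>v\<in>insert a A. m v = m' v" if m: "m \<in> M" "m' \<in> M"
      and e: "N * m a + S m = N * m' a + S m'" for m m'
    proof -
      have "(N * m a + S m) div N = (N * m' a + S m') div N" "(N * m a + S m) mod N = (N * m' a + S m') mod N"
        using e by auto
      then have "m a = m' a" "S m = S m'"
        using SN[OF m(1)] SN[OF m(2)] by (auto simp: div_mult_self4 mod_mult_self4)
      then show ?thesis using w m by (auto simp: S_def)
    qed
    then show ?case using eq by (intro exI[of _ "w(a := N)"]) auto
  qed
  then obtain w :: "'v \<Rightarrow> nat" where
    w: "\<forall>m\<in>M. \<forall>m'\<in>M. (\<Sum>v\<in>A. w v * m v) = (\<Sum>v\<in>A. w v * m' v) \<longrightarrow> (\<forall>v\<in>A. m v = m' v)" ..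
  have "inj_on (\<lambda>m. \<Sum>v\<in>A. w v * m v) M"
    by (rule inj_onI, rule assms(3)) (use w in auto)
  then show ?thesis by (intro exI[of _ w])
qed

text \<open>With separating weights distinct monomials become distinct powers of
  \<open>fps_X\<close>, so nothing cancels. Points over the field itself would not do: over a finite
  field a nonzero polynomial can vanish everywhere.\<close>

lemma peval_X_powers_nonzero:
  fixes p :: "('v, 'a::field) mpoly"
  assumes "p \<noteq> 0"
  shows "\<exists>w :: 'v \<Rightarrow> nat. peval fps_const (\<lambda>v. fps_X ^ w v) p \<noteq> 0"
proof -
  let ?A = "mpoly_vars p" and ?K = "Poly_Mapping.keys p"
  have fin: "finite ?A" by (auto simp: mpoly_vars_def)
  have "\<exists>w :: 'v \<Rightarrow> nat. inj_on (\<lambda>m. \<Sum>v\<in>?A. w v * m v) (Poly_Mapping.lookup ` ?K)"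
  proof (rule separating_weights[OF fin])
    fix m m' assume m: "m \<in> Poly_Mapping.lookup ` ?K" "m' \<in> Poly_Mapping.lookup ` ?K"
      and eq: "\<And>v. v \<in> ?A \<Longrightarrow> m v = m' v"
    have "v \<notin> ?A \<Longrightarrow> m v = 0 \<and> m' v = 0" for v
      using m by (auto simp: mpoly_vars_def in_keys_iff)
    with eq show "m = m'" by (metis ext)
  qed auto
  then obtain w :: "'v \<Rightarrow> nat" where w: "inj_on (\<lambda>m. \<Sum>v\<in>?A. w v * m v) (Poly_Mapping.lookup ` ?K)" by blast
  define S where "S m = (\<Sum>v\<in>?A. w v * Poly_Mapping.lookup m v)" for m
  have inj: "inj_on S ?K"
  proof (rule inj_onI)
    fix m m' assume m: "m \<in> ?K" "m' \<in> ?K" "S m = S m'"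
    have "Poly_Mapping.lookup m = Poly_Mapping.lookup m'"
      by (rule inj_onD[OF w]) (use m in \<open>auto simp: S_def\<close>)
    then show "m = m'"
      by (intro poly_mapping_eqI) simp
  qed
  have mono: "mono_eval (\<lambda>v. fps_X ^ w v :: 'a fps) m = fps_X ^ S m" if "m \<in> ?K" for m
  proof -
    have "Poly_Mapping.keys m \<subseteq> ?A" using that by (auto simp: mpoly_vars_def)
    then show ?thesis by (simp add: mono_eval_superset[OF fin] S_def power_sum power_mult)
  qed
  obtain m0 where m0: "m0 \<in> ?K" using assms by (metis all_not_in_conv keys_eq_empty)
  have "fps_nth (peval fps_const (\<lambda>v. fps_X ^ w v) p) (S m0) = (\<Sum>m\<in>?K. if m = m0 then Poly_Mapping.lookup p m else 0)"
    unfolding peval_def fps_sum_nth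
  proof (rule sum.cong)
    fix m assume m: "m \<in> ?K"
    have "S m = S m0 \<longleftrightarrow> m = m0" using inj m m0 by (auto simp: inj_on_def)
    then show "fps_nth (fps_const (Poly_Mapping.lookup p m) * mono_eval (\<lambda>v. fps_X ^ w v) m) (S m0) = (if m = m0 then Poly_Mapping.lookup p m else 0)"
      by (auto simp: mono[OF m])
  qed simp
  also have "\<dots> \<noteq> 0" using m0 by (simp add: sum.delta in_keys_iff)
  finally show ?thesis by (metis fps_zero_nth)
qed

lemma dvd_power_diff:
  fixes a b :: "'r::comm_ring_1"
  assumes "e dvd a - b" shows "e dvd a ^ n - b ^ n"
proof (induction n)
  case (Suc n)
  have "a ^ Suc n - b ^ Suc n = a * (a ^ n - b ^ n) + (a - b) * b ^ n" by (simp add: algebra_simps)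
  then show ?case using Suc assms by simp
qed simp

lemma dvd_prod_diff:
  fixes f g :: "'v \<Rightarrow> 'r::comm_ring_1"
  assumes "\<And>v. v \<in> A \<Longrightarrow> e dvd f v - g v" shows "e dvd prod f A - prod g A"
  using assms
proof (induction A rule: infinite_finite_induct)
  case (insert x F)
  have "prod f (insert x F) - prod g (insert x F) = f x * (prod f F - prod g F) + (f x - g x) * prod g F"
    using insert.hyps by (simp add: algebra_simps)
  then show ?case using insert by simp
qed auto

text \<open>This will replace matrix factors that are the identity up to a power of \<epsilon> by
  the identity, at the cost of a multiple of that power.\<close>

lemma dvd_peval_diff:
  assumes "\<And>v. e dvd s v - s' v"
  shows "e dvd peval \<phi> s p - peval \<phi> s' p"
  unfolding peval_def mono_eval_def sum_subtractf[symmetric] right_diff_distrib[symmetric]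
  by (intro dvd_sum dvd_mult dvd_prod_diff dvd_power_diff assms)

section \<open>An algebraic branching program for the determinant\<close>

lemma sum_div_mod:
  fixes F :: "nat \<Rightarrow> nat \<Rightarrow> 'b::comm_monoid_add"
  shows "(\<Sum>i<a * b. F (i div b) (i mod b)) = (\<Sum>p<a. \<Sum>q<b. F p q)"
proof -
  have "(\<Sum>i<a * b. F (i div b) (i mod b)) = (\<Sum>(p, q)\<in>{..<a} \<times> {..<b}. F p q)"
  proof (rule sum.reindex_bij_witness[where i = "\<lambda>(p, q). p * b + q" and j = "\<lambda>i. (i div b, i mod b)"])
    fix pq assume pq: "pq \<in> {..<a} \<times> {..<b}"
    obtain p q where [simp]: "pq = (p, q)" by (cases pq)
    have "p * b + q < Suc p * b" using pq by auto
    also have "\<dots> \<le> a * b" using pq by (intro mult_le_mono1) auto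
    finally show "(\<lambda>(p, q). p * b + q) pq \<in> {..<a * b}" by simp
    show "(((\<lambda>(p, q). p * b + q) pq) div b, ((\<lambda>(p, q). p * b + q) pq) mod b) = pq"
      using pq by simp
  next
    fix i assume i: "i \<in> {..<a * b}"
    then have "b > 0" by (cases "b = 0") auto
    with i show "(i div b, i mod b) \<in> {..<a} \<times> {..<b}"
      by (auto simp: less_mult_imp_div_less)
  qed (auto simp: case_prod_unfold)
  then show ?thesis by (simp add: sum.cartesian_product)
qed

lemma coeff_prod_linear:
  fixes p :: "'i \<Rightarrow> 'r::comm_ring_1 poly"
  assumes "finite A" "\<And>i. i \<in> A \<Longrightarrow> degree (p i) \<le> 1"
  shows "coeff (prod p A) (card A) = (\<Prod>i\<in>A. coeff (p i) 1)"
proof -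
  have "degree (prod p A) \<le> card A \<and> coeff (prod p A) (card A) = (\<Prod>i\<in>A. coeff (p i) 1)"
    using assms
  proof (induction A rule: finite_induct)
    case (insert x F)
    have d: "degree (p x) \<le> 1" "degree (prod p F) \<le> card F" using insert by auto
    have "p x = [:coeff (p x) 0, coeff (p x) 1:]"
    proof (rule poly_eqI)
      fix n
      show "coeff (p x) n = coeff [:coeff (p x) 0, coeff (p x) 1:] n"
        using d(1) by (cases n rule: nat.exhaust; cases "n - 1") (auto simp: coeff_eq_0)
    qed
    moreover have "coeff (prod p F) (Suc (card F)) = 0" using d by (simp add: coeff_eq_0)
    ultimately have "coeff (p x * prod p F) (1 + card F) = coeff (p x) 1 * coeff (prod p F) (card F)"
      by (metis (no_types, lifting) add.left_neutral coeff_pCons_Suc coeff_add coeff_smult mult_pCons_left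
          mult_zero_left mult_zero_right plus_1_eq_Suc smult_0_left pCons_0_0 add.right_neutral)
    moreover have "degree (p x * prod p F) \<le> 1 + card F"
      using degree_mult_le[of "p x" "prod p F"] d by linarith
    ultimately show ?case using insert by simp
  qed simp
  then show ?thesis ..
qed

context
  fixes A :: "'r::comm_ring_1 mat" and t :: nat
  assumes A: "A \<in> carrier_mat t t"
begin

text \<open>The leading \<open>k \<times> k\<close> block of \<open>1 - z A\<close>, with
  \<open>z\<close> the polynomial variable.\<close>

definition resolvent_minor :: "nat \<Rightarrow> 'r poly mat" where
  "resolvent_minor k = mat k k (\<lambda>(u, v). [:if u = v then 1 else 0, - A $$ (u, v):])"

text \<open>With \<open>A\<^sub>k\<close> the leading \<open>k \<times> k\<close> block of \<open>A\<close>, \<open>adj_row k v\<close> is entry \<open>v\<close> of the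
  last row of the adjugate of \<open>1 - z A\<close> restricted to the first \<open>k + 1\<close> indices. Comparing the last rows of
  \<open>adj M * M = det M * 1\<close> gives a recursion for the coefficients of these polynomials in which
  every step multiplies by a single entry of \<open>A\<close>.\<close>

definition adj_row :: "nat \<Rightarrow> nat \<Rightarrow> 'r poly" where
  "adj_row k v = adj_mat (resolvent_minor (Suc k)) $$ (k, v)"

text \<open>Deleting the last row and column leaves the next smaller block. So the determinant in
  \<open>adj_row_mult\<close> for \<open>k\<close> is the last entry of \<open>adj_row\<close> for
  \<open>k + 1\<close>, which links consecutive layers of the recursion.\<close>

lemma adj_row_last: "adj_row k k = det (resolvent_minor k)"
proof -
  have "mat_delete (resolvent_minor (Suc k)) k k = resolvent_minor k"
    by (rule eq_matI) (auto simp: mat_delete_def resolvent_minor_def)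
  then show ?thesis
    by (simp add: adj_row_def adj_mat_def cofactor_def resolvent_minor_def)
qed

lemma adj_row_mult:
  assumes "v \<le> k"
  shows "adj_row k v - [:0, 1:] * (\<Sum>u\<le>k. adj_row k u * [:A $$ (u, v):]) =
    (if v = k then det (resolvent_minor (Suc k)) else 0)"
proof -
  let ?M = "resolvent_minor (Suc k)"
  have M: "?M \<in> carrier_mat (Suc k) (Suc k)" by (simp add: resolvent_minor_def)
  note adj = adj_mat[OF M]
  have "(if v = k then det ?M else 0) = (adj_mat ?M * ?M) $$ (k, v)"
    using assms by (subst adj(3)) auto
  also have "\<dots> = (\<Sum>u<Suc k. adj_row k u * ?M $$ (u, v))"
    using adj(1) M assms by (auto simp: times_mat_def scalar_prod_def adj_row_def atLeast0LessThan intro!: sum.cong)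
  also have "\<dots> = (\<Sum>u<Suc k. (if u = v then adj_row k u else 0) - [:0, 1:] * (adj_row k u * [:A $$ (u, v):]))"
  proof (rule sum.cong[OF refl])
    fix u assume u: "u \<in> {..<Suc k}"
    have e: "[:if u = v then 1 else 0, - A $$ (u, v):] = (if u = v then 1 else 0) - [:0, 1:] * [:A $$ (u, v):]"
      by (simp add: one_pCons)
    show "adj_row k u * ?M $$ (u, v) = (if u = v then adj_row k u else 0) - [:0, 1:] * (adj_row k u * [:A $$ (u, v):])"
      using u assms by (simp only: resolvent_minor_def, simp del: mult_pCons_left mult_pCons_right add: e, simp del: mult_pCons_left mult_pCons_right add: algebra_simps)
  qed
  also have "\<dots> = adj_row k v - [:0, 1:] * (\<Sum>u\<le>k. adj_row k u * [:A $$ (u, v):])"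
    unfolding sum_subtractf sum_distrib_left[symmetric] using assms
    by (simp add: sum.delta lessThan_Suc_atMost del: mult_pCons_left mult_pCons_right)
  finally show ?thesis by simp
qed

lemma coeff_adj_row_mult:
  assumes "v \<le> k"
  shows "coeff (adj_row k v) 0 = (if v = k then coeff (det (resolvent_minor (Suc k))) 0 else 0)"
    and "coeff (adj_row k v) (Suc e) - (\<Sum>u\<le>k. coeff (adj_row k u) e * A $$ (u, v)) =
      (if v = k then coeff (det (resolvent_minor (Suc k))) (Suc e) else 0)"
proof -
  have e: "coeff (adj_row k v - [:0, 1:] * (\<Sum>u\<le>k. adj_row k u * [:A $$ (u, v):])) i =
    (if v = k then coeff (det (resolvent_minor (Suc k))) i else 0)" for i
    using adj_row_mult[OF assms] by auto
  show "coeff (adj_row k v) 0 = (if v = k then coeff (det (resolvent_minor (Suc k))) 0 else 0)"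
    using e[of 0] by simp
  show "coeff (adj_row k v) (Suc e) - (\<Sum>u\<le>k. coeff (adj_row k u) e * A $$ (u, v)) =
      (if v = k then coeff (det (resolvent_minor (Suc k))) (Suc e) else 0)"
    using e[of "Suc e"] by (simp add: coeff_sum mult.commute)
qed

text \<open>Every entry has degree at most 1 in \<open>z\<close>, so degree \<open>t\<close> in a
  product of \<open>t\<close> entries is reached only through the linear coefficient of
  each.\<close>

lemma coeff_det_resolvent: "coeff (det (resolvent_minor t)) t = (-1) ^ t * det A"
proof -
  have "coeff (det (resolvent_minor t)) t =
    (\<Sum>p | p permutes {0..<t}. coeff (signof p * (\<Prod>i = 0..<t. resolvent_minor t $$ (i, p i))) t)"
    by (simp add: det_def resolvent_minor_def coeff_sum)
  also have "\<dots> = (\<Sum>p | p permutes {0..<t}. (-1) ^ t * (signof p * (\<Prod>i = 0..<t. A $$ (i, p i))))"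
  proof (rule sum.cong[OF refl])
    fix p assume "p \<in> {p. p permutes {0..<t}}"
    then have p: "p i < t" if "i < t" for i using that by (simp add: permutes_nat_less)
    have "coeff (\<Prod>i = 0..<t. resolvent_minor t $$ (i, p i)) (card {0..<t}) =
        (\<Prod>i = 0..<t. coeff (resolvent_minor t $$ (i, p i)) 1)"
      by (rule coeff_prod_linear) (use p in \<open>auto simp: resolvent_minor_def\<close>)
    also have "\<dots> = (\<Prod>i = 0..<t. - A $$ (i, p i))"
      by (rule prod.cong) (use p in \<open>auto simp: resolvent_minor_def\<close>)
    also have "\<dots> = (-1) ^ t * (\<Prod>i = 0..<t. A $$ (i, p i))"
      by (simp add: prod_uminus)
    finally have "coeff (\<Prod>i = 0..<t. resolvent_minor t $$ (i, p i)) t = (-1) ^ t * (\<Prod>i = 0..<t. A $$ (i, p i))"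
      by simp
    then show "coeff (signof p * (\<Prod>i = 0..<t. resolvent_minor t $$ (i, p i))) t =
       (-1) ^ t * (signof p * (\<Prod>i = 0..<t. A $$ (i, p i)))"
      by (cases p rule: sign_cases) auto
  qed
  also have "\<dots> = (-1) ^ t * det A"
    using A by (simp add: det_def sum_distrib_left)
  finally show ?thesis .
qed

text \<open>A node \<open>(k, e, v)\<close> is encoded as the number \<open>(k * (t + 1) + e) * t + v\<close>.
  Its value is the coefficient of \<open>z ^ e\<close> in \<open>adj_row k v\<close>.\<close>

definition abp_node :: "nat \<Rightarrow> nat \<Rightarrow> nat \<Rightarrow> 'r" where
  "abp_node k e v = (if v \<le> k then coeff (adj_row k v) e else 0)"

text \<open>The recursion as edge weights. A node with \<open>v < k\<close> is fed by its own layer,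
  one power of \<open>z\<close> lower. The node \<open>v = k\<close> holds a coefficient of
  \<open>det (resolvent_minor k)\<close>; the relation for the last column in layer
  \<open>k - 1\<close> expresses it by the last node of that layer at the same \<open>e\<close> and
  by all its nodes at \<open>e - 1\<close>.\<close>

definition abp_edge :: "nat \<Rightarrow> nat \<Rightarrow> nat \<Rightarrow> nat \<Rightarrow> nat \<Rightarrow> nat \<Rightarrow> 'r" where
  "abp_edge k' e' u k e v =
    (if v < k then if k' = k \<and> Suc e' = e then A $$ (u, v) else 0
     else if v = k then
       (if Suc k' = k \<and> e' = e \<and> u = k' then 1 else 0) -
       (if Suc k' = k \<and> Suc e' = e then A $$ (u, k') else 0)
     else 0)"

lemma abp_node_sum:
  assumes "k < t"
  shows "(\<Sum>u<t. abp_node k e u * f u) = (\<Sum>u\<le>k. coeff (adj_row k u) e * f u)"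
proof -
  have "(\<Sum>u<t. abp_node k e u * f u) = (\<Sum>u\<le>k. abp_node k e u * f u)"
    by (rule sum.mono_neutral_right) (use assms in \<open>auto simp: abp_node_def\<close>)
  then show ?thesis by (simp add: abp_node_def)
qed

text \<open>The case split follows the types of edges; nodes with \<open>v > k\<close> are padding
  of value 0. The excluded triple is the source, which has value 1 and no incoming edge.\<close>

lemma abp_node_rec:
  assumes "k < t" "e < Suc t" "v < t" "(k, e, v) \<noteq> (0, 0, 0)"
  shows "abp_node k e v = (\<Sum>k'<t. \<Sum>e'<Suc t. \<Sum>u<t. abp_node k' e' u * abp_edge k' e' u k e v)"
proof -
  consider "v < k" | "v = k" "k = 0" | k0 where "v = k" "k = Suc k0" | "v > k"
    by (metis linorder_cases not0_implies_Suc)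
  then show ?thesis
  proof cases
    case 1
    show ?thesis
    proof (cases e)
      case 0
      then show ?thesis using 1 coeff_adj_row_mult(1)[of v k] by (simp add: abp_edge_def abp_node_def)
    next
      case (Suc e0)
      have "(\<Sum>k'<t. \<Sum>e'<Suc t. \<Sum>u<t. abp_node k' e' u * abp_edge k' e' u k e v) =
         (\<Sum>k'<t. if k' = k then \<Sum>e'<Suc t. if e' = e0 then \<Sum>u<t. abp_node k e0 u * A $$ (u, v) else 0 else 0)"
        using 1 Suc by (intro sum.cong[OF refl]) (auto simp: abp_edge_def simp del: sum.lessThan_Suc sum.delta sum.delta' intro!: sum.cong)
      also have "\<dots> = (\<Sum>u<t. abp_node k e0 u * A $$ (u, v))"
        using assms Suc by (simp add: sum.delta)
      also have "\<dots> = coeff (adj_row k v) e"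
        using coeff_adj_row_mult(2)[of v k e0] 1 Suc assms by (simp add: abp_node_sum)
      finally show ?thesis using 1 by (simp add: abp_node_def)
    qed
  next
    case 2
    then have "e > 0" using assms by auto
    \<comment> \<open>The determinant of the empty block is the constant 1, so nodes with
      \<open>k = v = 0\<close> and positive \<open>e\<close> have value 0; they receive no edge
      either.\<close>
    moreover have "adj_row 0 0 = 1" by (simp add: adj_row_last resolvent_minor_def)
    ultimately show ?thesis using 2 by (simp add: abp_edge_def abp_node_def)
  next
    case 3
    have k0: "k0 < t" using 3 assms by simp
    have "(\<Sum>k'<t. \<Sum>e'<Suc t. \<Sum>u<t. abp_node k' e' u * abp_edge k' e' u k e v) =
      (\<Sum>k'<t. if k' = k0 then \<Sum>e'<Suc t. (if e' = e then \<Sum>u<t. if u = k0 then abp_node k0 e k0 else 0 else 0)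
         - (if Suc e' = e then \<Sum>u<t. abp_node k0 e' u * A $$ (u, k0) else 0) else 0)"
      using 3 by (intro sum.cong) (auto simp: abp_edge_def right_diff_distrib sum_subtractf simp del: sum.lessThan_Suc sum.delta sum.delta' intro!: sum.cong arg_cong2[where f = "(-)"])
    also have "\<dots> = abp_node k0 e k0 - (\<Sum>e'<Suc t. if Suc e' = e then \<Sum>u<t. abp_node k0 e' u * A $$ (u, k0) else 0)"
      using k0 assms(2) by (simp add: sum.delta sum_subtractf del: sum.lessThan_Suc)
    also have "\<dots> = coeff (det (resolvent_minor (Suc k0))) e"
    proof (cases e)
      case 0
      then show ?thesis using coeff_adj_row_mult(1)[of k0 k0] by (simp add: abp_node_def)
    next
      case (Suc e0)
      have "(\<Sum>e'<Suc t. if Suc e' = e then \<Sum>u<t. abp_node k0 e' u * A $$ (u, k0) else 0) =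
        (\<Sum>u<t. abp_node k0 e0 u * A $$ (u, k0))"
        using Suc assms by (simp add: sum.delta del: sum.lessThan_Suc)
      moreover have "abp_node k0 e k0 = coeff (adj_row k0 k0) e" by (simp add: abp_node_def)
      ultimately show ?thesis
        using coeff_adj_row_mult(2)[of k0 k0 e0] Suc k0 by (simp add: abp_node_sum del: sum.lessThan_Suc)
    qed
    finally show ?thesis using 3 by (simp add: abp_node_def adj_row_last)
  next
    case 4
    then show ?thesis by (simp add: abp_edge_def abp_node_def)
  qed
qed

text \<open>Along an edge either \<open>k\<close> stays and \<open>e\<close> grows by 1, or
  \<open>k\<close> grows by 1. As \<open>k\<close> and \<open>e\<close> are the leading digits of
  the encoding, the number grows whatever happens to \<open>v\<close>.\<close>

lemma abp_edge_forward:
  assumes "abp_edge (i div t div Suc t) (i div t mod Suc t) (i mod t) (j div t div Suc t) (j div t mod Suc t) (j mod t) \<noteq> 0"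
  shows "i < j"
proof -
  let ?I = "i div t" and ?J = "j div t"
  have "?I < ?J"
  proof -
    have *: "?I = (?I div Suc t) * Suc t + ?I mod Suc t" "?J = (?J div Suc t) * Suc t + ?J mod Suc t"
      by (rule div_mult_mod_eq[symmetric])+
    consider "?I div Suc t = ?J div Suc t" "Suc (?I mod Suc t) = ?J mod Suc t"
      | "Suc (?I div Suc t) = ?J div Suc t" 
      using assms by (auto simp: abp_edge_def split: if_splits)
    then show ?thesis
    proof cases
      case 1
      then show ?thesis using * by simp
    next
      case 2
      have "?J = Suc (?I div Suc t) * Suc t + ?J mod Suc t" using *(2) unfolding 2 .
      then have "?J = (?I div Suc t) * Suc t + Suc t + ?J mod Suc t" by (simp only: mult_Suc add.commute add.left_commute)
      moreover have "?I mod Suc t < Suc t" by simp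
      ultimately show ?thesis using *(1) by linarith
    qed
  qed
  then show ?thesis by (metis div_le_mono leD leI)
qed

text \<open>\<open>S\<close> stands for the set of admissible labels and will be the set of affine
  polynomials. Closure under differences suffices because no label is a product of entries of
  \<open>A\<close>.\<close>

lemma det_algebraic_branching_program:
  assumes t: "t \<ge> 1"
    and S: "0 \<in> S" "1 \<in> S" "\<And>a b. a \<in> S \<Longrightarrow> b \<in> S \<Longrightarrow> a - b \<in> S"
      "\<And>u v. u < t \<Longrightarrow> v < t \<Longrightarrow> A $$ (u, v) \<in> S"
  shows "\<exists>x B c. x 0 = 1 \<and> (\<forall>j\<ge>1. x j = (\<Sum>i<j. x i * B i j)) \<and>
     det A = (\<Sum>i<t * Suc t * t. x i * c i) \<and> (\<forall>i j. B i j \<in> S) \<and> (\<forall>i. c i \<in> S)"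
proof -
  define m where "m = t * Suc t * t"
  \<comment> \<open>Padding by 0 beyond the \<open>m\<close> nodes makes the recursion hold for
    every \<open>j \<ge> 1\<close>.\<close>
  define x where "x j = (if j < m then abp_node (j div t div Suc t) (j div t mod Suc t) (j mod t) else 0)" for j
  define B where "B i j = (if i < m \<and> j < m then abp_edge (i div t div Suc t) (i div t mod Suc t) (i mod t)
       (j div t div Suc t) (j div t mod Suc t) (j mod t) else 0)" for i j
  obtain t0 where t0: "t = Suc t0" using t by (cases t) auto
  define s where "s = (-1 :: 'r) ^ t"
  \<comment> \<open>The output weights perform one more step of the recursion out of the last layer
    \<open>t0 = t - 1\<close>, which yields the coefficient of \<open>z ^ t\<close> in
    \<open>det (resolvent_minor t)\<close>. The factor \<open>s\<close> removes its sign.\<close>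
  define c3 where "c3 k e v = (if k = t0 \<and> e = t \<and> v = t0 then s else 0)
     - (if k = t0 \<and> e = t0 then s * A $$ (v, t0) else 0)" for k e v
  define c where "c i = c3 (i div t div Suc t) (i div t mod Suc t) (i mod t)" for i
  have sum3: "(\<Sum>i<m. F (i div t div Suc t) (i div t mod Suc t) (i mod t)) = (\<Sum>k<t. \<Sum>e<Suc t. \<Sum>v<t. F k e v)" for F :: "nat \<Rightarrow> nat \<Rightarrow> nat \<Rightarrow> 'r"
    using sum_div_mod[where F = "\<lambda>p. F (p div Suc t) (p mod Suc t)" and a = "t * Suc t" and b = t]
      sum_div_mod[where F = "\<lambda>k e. \<Sum>v<t. F k e v" and a = t and b = "Suc t"] unfolding m_def by (simp only:)
  have bounds: "j div t div Suc t < t" "j mod t < t" if "j < m" for j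
    using that t by (auto simp: m_def less_mult_imp_div_less)
  have node0: "adj_row 0 0 = 1" by (simp add: adj_row_last resolvent_minor_def)
  have x0: "x 0 = 1" using t by (simp add: x_def m_def abp_node_def node0)
  have xrec: "x j = (\<Sum>i<j. x i * B i j)" if j: "j \<ge> 1" for j
  proof (cases "j < m")
    case True
    let ?k = "j div t div Suc t" and ?e = "j div t mod Suc t" and ?v = "j mod t"
    have "(?k, ?e, ?v) \<noteq> (0, 0, 0)"
    proof
      assume "(?k, ?e, ?v) = (0, 0, 0)"
      then have "j div t = 0" "j mod t = 0" using div_mult_mod_eq[of "j div t" "Suc t"] by auto
      then have "j = 0" using div_mult_mod_eq[of j t] by auto
      with j show False by simp
    qed
    then have "x j = (\<Sum>k'<t. \<Sum>e'<Suc t. \<Sum>u<t. abp_node k' e' u * abp_edge k' e' u ?k ?e ?v)"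
      using True bounds[OF True] by (simp only: x_def if_True) (rule abp_node_rec, auto)
    also have "\<dots> = (\<Sum>i<m. x i * B i j)"
      unfolding sum3[symmetric] by (rule sum.cong) (use True in \<open>auto simp: x_def B_def\<close>)
    also have "\<dots> = (\<Sum>i<j. x i * B i j)"
    proof (rule sum.mono_neutral_right)
      have "B i j = 0" if "\<not> i < j" for i
        using abp_edge_forward[of i j] that by (metis B_def)
      then show "\<forall>i\<in>{..<m} - {..<j}. x i * B i j = 0" by auto
    qed (use True in auto)
    finally show ?thesis .
  qed (auto simp: x_def B_def)
  have B: "B i j \<in> S" for i j
  proof -
    have "abp_edge k' e' u k e v \<in> S" if "u < t" "v < t" "k' < t" for k' e' u k e v
      using that S by (auto simp: abp_edge_def)
    then show ?thesis using S(1) bounds by (auto simp: B_def)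
  qed
  have neg: "- a \<in> S" if "a \<in> S" for a using S(3)[OF S(1) that] by simp
  have s: "s * a \<in> S" if "a \<in> S" for a
    using that neg by (cases "even t") (auto simp: s_def)
  have c: "c i \<in> S" for i
  proof -
    have "i mod t < t" "t0 < t" using t0 by auto
    then have "s * 1 \<in> S" "s * A $$ (i mod t, t0) \<in> S" by (intro s S)+
    then show ?thesis unfolding c_def c3_def by (intro S(3)) (auto intro: S(1))
  qed
  have "(\<Sum>i<m. x i * c i) = (\<Sum>k<t. \<Sum>e<Suc t. \<Sum>v<t. abp_node k e v * c3 k e v)"
    unfolding sum3[symmetric] by (rule sum.cong) (auto simp: x_def c_def)
  also have "\<dots> = (\<Sum>k<t. if k = t0 then \<Sum>e<Suc t. (if e = t then \<Sum>v<t. if v = t0 then abp_node t0 t t0 * s else 0 else 0)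
       - (if e = t0 then \<Sum>v<t. abp_node t0 t0 v * (s * A $$ (v, t0)) else 0) else 0)"
    by (intro sum.cong) (auto simp: c3_def right_diff_distrib sum_subtractf simp del: sum.lessThan_Suc sum.delta sum.delta' intro!: sum.cong arg_cong2[where f = "(-)"])
  also have "\<dots> = abp_node t0 t t0 * s - (\<Sum>v<t. abp_node t0 t0 v * (s * A $$ (v, t0)))"
    using t0 by (simp add: sum.delta sum_subtractf del: sum.lessThan_Suc)
  also have "\<dots> = s * (coeff (adj_row t0 t0) (Suc t0) - (\<Sum>u\<le>t0. coeff (adj_row t0 u) t0 * A $$ (u, t0)))"
  proof -
    have "(\<Sum>v<t. abp_node t0 t0 v * (s * A $$ (v, t0))) = (\<Sum>u\<le>t0. coeff (adj_row t0 u) t0 * (s * A $$ (u, t0)))"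
      by (rule abp_node_sum) (simp add: t0)
    moreover have "abp_node t0 t t0 = coeff (adj_row t0 t0) (Suc t0)" by (simp add: abp_node_def t0)
    ultimately show ?thesis by (simp add: right_diff_distrib sum_distrib_left mult_ac)
  qed
  also have "\<dots> = s * coeff (det (resolvent_minor t)) t"
    using coeff_adj_row_mult(2)[of t0 t0 t0] t0 by simp
  also have "\<dots> = det A"
    by (simp add: coeff_det_resolvent s_def flip: power_mult_distrib mult.assoc)
  finally have "det A = (\<Sum>i<t * Suc t * t. x i * c i)" by (simp add: m_def)
  with x0 xrec B c show ?thesis by blast
qed

end

section \<open>Substitution into circuits\<close>

text \<open>The common form of the folds in \<open>circuit_poly\<close> and
  \<open>product_depth\<close>, so that facts on positions are proved once for both.\<close>

definition fold_gates :: "('b list \<Rightarrow> 'g \<Rightarrow> 'b) \<Rightarrow> 'g list \<Rightarrow> 'b list" where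
  "fold_gates f \<Phi> = foldl (\<lambda>ps G. ps @ [f ps G]) [] \<Phi>"

lemma fold_gates_Nil [simp]: "fold_gates f [] = []"
  by (simp add: fold_gates_def)

lemma fold_gates_snoc [simp]: "fold_gates f (\<Phi> @ [G]) = fold_gates f \<Phi> @ [f (fold_gates f \<Phi>) G]"
  by (simp add: fold_gates_def)

lemma length_fold_gates [simp]: "length (fold_gates f \<Phi>) = length \<Phi>"
  by (induction \<Phi> rule: rev_induct) auto

lemma fold_gates_append: "\<exists>qs. fold_gates f (\<Phi> @ \<Psi>) = fold_gates f \<Phi> @ qs"
proof (induction \<Psi> rule: rev_induct)
  case (snoc G \<Psi>)
  then show ?case by (metis append.assoc fold_gates_snoc)
qed simp

lemma nth_fold_gates_append:
  assumes "i < length \<Phi>"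
  shows "fold_gates f (\<Phi> @ \<Psi>) ! i = fold_gates f \<Phi> ! i"
  using fold_gates_append[of f \<Phi> \<Psi>] assms by (auto simp: nth_append)

text \<open>\<open>circuit_on\<close> without nonemptiness, so that circuits can grow from the empty
  list.\<close>

definition well_formed :: "'v set \<Rightarrow> ('v, 'c) circuit \<Rightarrow> bool" where
  "well_formed A \<Phi> \<longleftrightarrow>
     (\<forall>i<length \<Phi>. (\<forall>j\<in>set (children (\<Phi> ! i)). j < i) \<and> (\<forall>v. \<Phi> ! i = InVar v \<longrightarrow> v \<in> A))"

lemma circuit_on_iff: "circuit_on A \<Phi> \<longleftrightarrow> \<Phi> \<noteq> [] \<and> well_formed A \<Phi>"
  by (simp add: circuit_on_def well_formed_def)

lemma well_formed_Nil [simp]: "well_formed A []"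
  by (simp add: well_formed_def)

lemma well_formed_snoc:
  "well_formed A (\<Phi> @ [G]) \<longleftrightarrow> well_formed A \<Phi> \<and>
     (\<forall>j\<in>set (children G). j < length \<Phi>) \<and> (\<forall>v. G = InVar v \<longrightarrow> v \<in> A)"
  by (auto simp: well_formed_def nth_append less_Suc_eq)

lemma gate_poly_cong:
  assumes "\<And>j. j \<in> set (children G) \<Longrightarrow> ps ! j = qs ! j"
  shows "gate_poly ps G = gate_poly qs G"
proof (cases G)
  case (Add ws)
  then show ?thesis using assms by (force intro!: arg_cong[of _ _ sum_list])
next
  case (Mult js)
  then show ?thesis using assms by (auto intro!: arg_cong[of _ _ prod_list])
qed auto

lemma gate_pdepth_cong:
  assumes "\<And>j. j \<in> set (children G) \<Longrightarrow> ps ! j = qs ! j"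
  shows "gate_pdepth ps G = gate_pdepth qs G"
proof (cases G)
  case (Add ws)
  have "(\<lambda>(c, i). ps ! i) ` set ws = (\<lambda>(c, i). qs ! i) ` set ws"
    by (rule image_cong) (use assms Add in force)+
  then show ?thesis using Add by simp
next
  case (Mult js)
  have "(\<lambda>i. ps ! i) ` set js = (\<lambda>i. qs ! i) ` set js"
    by (rule image_cong) (use assms Mult in force)+
  then show ?thesis using Mult by simp
qed auto

text \<open>By \<open>cong\<close> a gate reads only the results of its children, which precede it;
  hence the complete list of results can replace the prefix available when the gate was
  processed.\<close>

lemma nth_fold_gates:
  assumes "well_formed A \<Phi>" "i < length \<Phi>"
    and cong: "\<And>G ps qs. (\<And>j. j \<in> set (children G) \<Longrightarrow> ps ! j = qs ! j) \<Longrightarrow> f ps G = f qs G"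
  shows "fold_gates f \<Phi> ! i = f (fold_gates f \<Phi>) (\<Phi> ! i)"
  using assms(1,2)
proof (induction \<Phi> rule: rev_induct)
  case (snoc G \<Phi>)
  show ?case
  proof (cases "i < length \<Phi>")
    case True
    then have "fold_gates f (\<Phi> @ [G]) ! i = f (fold_gates f \<Phi>) (\<Phi> ! i)"
      using snoc by (simp add: well_formed_snoc nth_append)
    also have "\<dots> = f (fold_gates f (\<Phi> @ [G])) (\<Phi> ! i)"
    proof (rule cong)
      fix j assume "j \<in> set (children (\<Phi> ! i))"
      then have "j < i" using snoc.prems True by (auto simp: well_formed_def nth_append)
      then show "fold_gates f \<Phi> ! j = fold_gates f (\<Phi> @ [G]) ! j"
        using True by (simp add: nth_append)
    qed
    finally show ?thesis using True by (simp add: nth_append)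
  next
    case False
    then have i: "i = length \<Phi>" using snoc.prems by simp
    have "f (fold_gates f \<Phi>) G = f (fold_gates f (\<Phi> @ [G])) G"
      by (rule cong) (use snoc.prems in \<open>auto simp: well_formed_snoc nth_append\<close>)
    then show ?thesis using i by (simp add: nth_append)
  qed
qed simp

abbreviation gate_polys :: "('v, 'c::comm_ring_1) circuit \<Rightarrow> ('v, 'c) mpoly list" where
  "gate_polys \<equiv> fold_gates gate_poly"

abbreviation gate_pdepths :: "('v, 'c) circuit \<Rightarrow> nat list" where
  "gate_pdepths \<equiv> fold_gates gate_pdepth"

lemma circuit_poly_eq: "circuit_poly \<Phi> = last (gate_polys \<Phi>)"
  by (simp add: circuit_poly_def fold_gates_def)

lemma product_depth_eq: "product_depth \<Phi> = last (gate_pdepths \<Phi>)"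
  by (simp add: product_depth_def fold_gates_def)

lemma nth_gate_polys:
  "well_formed A \<Phi> \<Longrightarrow> i < length \<Phi> \<Longrightarrow> gate_polys \<Phi> ! i = gate_poly (gate_polys \<Phi>) (\<Phi> ! i)"
  by (rule nth_fold_gates) (auto intro: gate_poly_cong)

lemma nth_gate_pdepths:
  "well_formed A \<Phi> \<Longrightarrow> i < length \<Phi> \<Longrightarrow> gate_pdepths \<Phi> ! i = gate_pdepth (gate_pdepths \<Phi>) (\<Phi> ! i)"
  by (rule nth_fold_gates) (auto intro: gate_pdepth_cong)

lemma circuit_size_append [simp]: "circuit_size (\<Phi> @ \<Psi>) = circuit_size \<Phi> + circuit_size \<Psi>"
  by (simp add: circuit_size_def)

section \<open>Appending gates to a circuit\<close>

definition computed :: "('v, 'c::comm_ring_1) circuit \<Rightarrow> nat \<Rightarrow> ('v, 'c) mpoly \<Rightarrow> bool" where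
  "computed \<Phi> d p \<longleftrightarrow> (\<exists>i<length \<Phi>. gate_polys \<Phi> ! i = p \<and> gate_pdepths \<Phi> ! i \<le> d)"

lemma computed_append: "computed \<Phi> d p \<Longrightarrow> computed (\<Phi> @ \<Psi>) d p"
  unfolding computed_def by (metis length_append nth_fold_gates_append trans_less_add1)

lemma computed_mono: "computed \<Phi> d p \<Longrightarrow> d \<le> d' \<Longrightarrow> computed \<Phi> d' p"
  unfolding computed_def using order_trans by blast

definition one_gate :: "'v set \<Rightarrow> ('v, 'c::comm_ring_1) circuit \<Rightarrow> nat \<Rightarrow> nat \<Rightarrow> ('v, 'c) mpoly \<Rightarrow> bool" where
  "one_gate A \<Phi> d c p \<longleftrightarrow> (\<exists>G. (\<forall>j\<in>set (children G). j < length \<Phi>) \<and> (\<forall>v. G = InVar v \<longrightarrow> v \<in> A) \<and>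
     gate_poly (gate_polys \<Phi>) G = p \<and> gate_pdepth (gate_pdepths \<Phi>) G \<le> d \<and> length (children G) \<le> c)"

text \<open>All new gates read gates of \<open>\<Phi>\<close> only, never each other, so they can be
  appended one by one and share the depth bound \<open>d\<close>.\<close>

lemma extend_circuit:
  assumes "finite T" "well_formed A \<Phi>" "\<And>p. p \<in> T \<Longrightarrow> one_gate A \<Phi> d c p"
  shows "\<exists>\<Psi>. well_formed A (\<Phi> @ \<Psi>) \<and> circuit_size \<Psi> \<le> c * card T \<and> (\<forall>p\<in>T. computed (\<Phi> @ \<Psi>) d p)"
  using assms(1,3)
proof (induction T rule: finite_induct)
  case empty
  show ?case by (rule exI[of _ "[]"]) (use assms(2) in \<open>simp add: circuit_size_def\<close>)
next
  case (insert p T)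
  then obtain \<Psi> where \<Psi>: "well_formed A (\<Phi> @ \<Psi>)" "circuit_size \<Psi> \<le> c * card T" "\<forall>p\<in>T. computed (\<Phi> @ \<Psi>) d p"
    by auto
  obtain G where G: "\<forall>j\<in>set (children G). j < length \<Phi>" "\<forall>v. G = InVar v \<longrightarrow> v \<in> A"
     "gate_poly (gate_polys \<Phi>) G = p" "gate_pdepth (gate_pdepths \<Phi>) G \<le> d" "length (children G) \<le> c"
    using insert.prems[of p] by (auto simp: one_gate_def)
  have "gate_poly (gate_polys (\<Phi> @ \<Psi>)) G = p"
    by (subst G(3)[symmetric], rule gate_poly_cong) (use G(1) in \<open>simp add: nth_fold_gates_append\<close>)
  moreover have "gate_pdepth (gate_pdepths (\<Phi> @ \<Psi>)) G = gate_pdepth (gate_pdepths \<Phi>) G"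
    by (rule gate_pdepth_cong) (use G(1) in \<open>simp add: nth_fold_gates_append\<close>)
  ultimately have "computed ((\<Phi> @ \<Psi>) @ [G]) d p"
    unfolding computed_def using G(4) by (intro exI[of _ "length (\<Phi> @ \<Psi>)"]) (simp add: nth_append del: append_assoc)
  moreover have "\<forall>p\<in>T. computed ((\<Phi> @ \<Psi>) @ [G]) d p" using \<Psi>(3) computed_append by blast
  moreover have "well_formed A ((\<Phi> @ \<Psi>) @ [G])"
    unfolding well_formed_snoc using \<Psi>(1) G(1,2) by auto
  moreover have "circuit_size (\<Psi> @ [G]) \<le> c * card (insert p T)"
    using \<Psi>(2) G(5) insert.hyps by (simp add: circuit_size_def)
  ultimately show ?case by (intro exI[of _ "\<Psi> @ [G]"]) auto
qed

lemma one_gate_Var: "v \<in> A \<Longrightarrow> one_gate A \<Phi> d c (Var v)"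
  unfolding one_gate_def by (rule exI[of _ "InVar v"]) auto

lemma one_gate_Const: "one_gate A \<Phi> d c (Const a)"
  unfolding one_gate_def by (rule exI[of _ "InConst a"]) auto

lemma one_gate_sum:
  assumes "finite I" "\<And>i. i \<in> I \<Longrightarrow> computed \<Phi> d (f i)" "card I \<le> c"
  shows "one_gate A \<Phi> d c (\<Sum>i\<in>I. Const (a i) * f i)"
proof -
  obtain \<rho> where \<rho>: "\<And>i. i \<in> I \<Longrightarrow> \<rho> i < length \<Phi> \<and> gate_polys \<Phi> ! \<rho> i = f i \<and> gate_pdepths \<Phi> ! \<rho> i \<le> d"
    using assms(2) unfolding computed_def by metis
  obtain xs where xs: "set xs = I" "distinct xs" using assms(1) finite_distinct_list by blast
  let ?G = "Add (map (\<lambda>i. (a i, \<rho> i)) xs)"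
  have "gate_poly (gate_polys \<Phi>) ?G = (\<Sum>i\<leftarrow>xs. Const (a i) * f i)"
    using \<rho> xs by (auto simp: comp_def intro!: arg_cong[of _ _ sum_list])
  also have "\<dots> = (\<Sum>i\<in>I. Const (a i) * f i)"
    using xs by (simp add: sum_list_distinct_conv_sum_set)
  finally have "gate_poly (gate_polys \<Phi>) ?G = (\<Sum>i\<in>I. Const (a i) * f i)" .
  moreover have "gate_pdepth (gate_pdepths \<Phi>) ?G \<le> d"
    using \<rho> xs by (auto simp: image_image)
  moreover have "length (children ?G) \<le> c"
    using assms(3) xs distinct_card by fastforce
  moreover have "\<forall>j\<in>set (children ?G). j < length \<Phi>"
    using \<rho> xs by auto
  ultimately show ?thesis unfolding one_gate_def by (intro exI[of _ ?G]) auto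
qed

lemma one_gate_lincomb2:
  assumes "computed \<Phi> d p" "computed \<Phi> d q"
  shows "one_gate A \<Phi> d 2 (Const a * p + Const b * q)"
  using one_gate_sum[of "{0, 1::nat}" \<Phi> d "\<lambda>i. if i = 0 then p else q" 2 A "\<lambda>i. if i = 0 then a else b"] assms
  by auto

lemma one_gate_diff:
  assumes "computed \<Phi> d p" "computed \<Phi> d q"
  shows "one_gate A \<Phi> d 2 (p - q)"
proof -
  interpret comm_ring_hom Const by (rule comm_ring_hom_Const)
  have "Const 1 * p + Const (-1) * q = p - q" by (simp add: hom_uminus)
  then show ?thesis using one_gate_lincomb2[OF assms, of A 1 "-1"] by simp
qed

lemma one_gate_mult:
  assumes "computed \<Phi> d p" "computed \<Phi> d q"
  shows "one_gate A \<Phi> (Suc d) 2 (p * q)"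
proof -
  obtain i j where "i < length \<Phi> \<and> gate_polys \<Phi> ! i = p \<and> gate_pdepths \<Phi> ! i \<le> d"
     "j < length \<Phi> \<and> gate_polys \<Phi> ! j = q \<and> gate_pdepths \<Phi> ! j \<le> d"
    using assms unfolding computed_def by metis
  then show ?thesis unfolding one_gate_def by (intro exI[of _ "Mult [i, j]"]) auto
qed

section \<open>Replacing the inputs of a circuit\<close>

text \<open>Where to find the value of gate \<open>j\<close> once the circuit stands behind a prefix
  of length \<open>l\<close>: an input is read from the prefix gate that \<open>\<rho>\<close>
  assigns to its variable, any other gate is shifted.\<close>

definition redirect :: "nat \<Rightarrow> ('v \<Rightarrow> nat) \<Rightarrow> ('v, 'c) circuit \<Rightarrow> nat \<Rightarrow> nat" where
  "redirect l \<rho> \<Phi> j = (case \<Phi> ! j of InVar v \<Rightarrow> \<rho> v | _ \<Rightarrow> l + j)"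

text \<open>Input gates become idle, and the wires leaving them are redirected. An addition gate in place
  of an input gate would add a wire for each of the possibly many input gates.\<close>

fun redirect_gate :: "('c \<Rightarrow> 'd::zero) \<Rightarrow> (nat \<Rightarrow> nat) \<Rightarrow> ('v, 'c) gate \<Rightarrow> ('w, 'd) gate" where
  "redirect_gate \<kappa> ix (InVar v) = InConst 0"
| "redirect_gate \<kappa> ix (InConst c) = InConst (\<kappa> c)"
| "redirect_gate \<kappa> ix (Add ws) = Add (map (\<lambda>(c, j). (\<kappa> c, ix j)) ws)"
| "redirect_gate \<kappa> ix (Mult js) = Mult (map ix js)"

lemma children_redirect_gate: "set (children (redirect_gate \<kappa> ix G)) \<subseteq> ix ` set (children G)"
  by (cases G) (auto, force)

lemma length_children_redirect_gate: "length (children (redirect_gate \<kappa> ix G)) = length (children G)"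
  by (cases G) auto

lemma redirect_gate_neq_InVar: "redirect_gate \<kappa> ix G \<noteq> InVar v"
  by (cases G) auto

text \<open>A path runs through the copy of \<open>\<Phi>\<close> and then through
  \<open>\<Gamma>\<close>, so depths add. The outer affine map with \<open>a\<close> and
  \<open>b\<close> is one addition gate with two wires; it will solve for the determinant.\<close>

lemma substitute_circuit:
  fixes \<Phi> :: "('v, 'c::comm_ring_1) circuit" and \<Gamma> :: "('w, 'd::comm_ring_1) circuit"
  assumes \<Phi>: "circuit_on A' \<Phi>" and \<kappa>: "comm_ring_hom \<kappa>" and \<Gamma>: "well_formed A \<Gamma>"
    and s: "\<And>v. v \<in> A' \<Longrightarrow> computed \<Gamma> d (s v)" and one: "computed \<Gamma> d 1"
  shows "\<exists>\<Psi>. circuit_on A \<Psi> \<and>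
     circuit_poly \<Psi> = Const a * peval (\<lambda>c. Const (\<kappa> c)) s (circuit_poly \<Phi>) + Const b \<and>
     product_depth \<Psi> \<le> product_depth \<Phi> + d \<and>
     circuit_size \<Psi> \<le> circuit_size \<Gamma> + circuit_size \<Phi> + 2"
proof -
  interpret K: comm_ring_hom \<kappa> by fact
  have KC: "comm_ring_hom (\<lambda>c. Const (\<kappa> c) :: ('w, 'd) mpoly)"
    by (rule comm_ring_hom_compose[OF \<kappa> comm_ring_hom_Const])
  then interpret KC: comm_ring_hom "\<lambda>c. Const (\<kappa> c) :: ('w, 'd) mpoly" .
  interpret E: comm_ring_hom "peval (\<lambda>c. Const (\<kappa> c) :: ('w, 'd) mpoly) s"
    by (rule KC.comm_ring_hom_peval)
  have wf: "well_formed A' \<Phi>" and ne: "\<Phi> \<noteq> []" using \<Phi> by (auto simp: circuit_on_iff)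
  obtain \<rho> where \<rho>: "\<And>v. v \<in> A' \<Longrightarrow> \<rho> v < length \<Gamma> \<and> gate_polys \<Gamma> ! \<rho> v = s v \<and> gate_pdepths \<Gamma> ! \<rho> v \<le> d"
    using s unfolding computed_def by metis
  define ix where "ix = redirect (length \<Gamma>) \<rho> \<Phi>"
  define \<Psi> where "\<Psi> = \<Gamma> @ map (redirect_gate \<kappa> ix) \<Phi>"
  have ix_le: "ix j < length \<Gamma> + i" if "j < i" "i \<le> length \<Phi>" for i j
  proof (cases "\<Phi> ! j")
    case (InVar v)
    moreover have "j < length \<Phi>" using that by simp
    ultimately have "v \<in> A'" using wf by (auto simp: well_formed_def)
    then show ?thesis using \<rho>[of v] InVar by (simp add: ix_def redirect_def)
  qed (use that in \<open>auto simp: ix_def redirect_def\<close>)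
  have wf\<Psi>: "well_formed A \<Psi>"
    unfolding well_formed_def
  proof (intro allI impI)
    fix i assume i: "i < length \<Psi>"
    show "(\<forall>j\<in>set (children (\<Psi> ! i)). j < i) \<and> (\<forall>v. \<Psi> ! i = InVar v \<longrightarrow> v \<in> A)"
    proof (cases "i < length \<Gamma>")
      case True
      then show ?thesis using \<Gamma> by (simp add: \<Psi>_def nth_append well_formed_def)
    next
      case False
      define i' where "i' = i - length \<Gamma>"
      have i': "i' < length \<Phi>" "i = length \<Gamma> + i'" using False i by (auto simp: \<Psi>_def i'_def)
      have "\<Psi> ! i = redirect_gate \<kappa> ix (\<Phi> ! i')" using i' by (simp add: \<Psi>_def nth_append)
      moreover have "j < i" if j: "j \<in> set (children (redirect_gate \<kappa> ix (\<Phi> ! i')))" for j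
      proof -
        obtain j' where "j' \<in> set (children (\<Phi> ! i'))" "j = ix j'"
          using children_redirect_gate[of \<kappa> ix "\<Phi> ! i'"] j by blast
        then show ?thesis using wf i' ix_le[of j' i'] by (auto simp: well_formed_def)
      qed
      ultimately show ?thesis by (auto simp: redirect_gate_neq_InVar dest: sym)
    qed
  qed
  \<comment> \<open>The induction is about position \<open>ix i\<close>, since the copy of an input
    gate holds 0 and its intended value sits in \<open>\<Gamma>\<close>.\<close>
  have main: "gate_polys \<Psi> ! ix i = peval (\<lambda>c. Const (\<kappa> c)) s (gate_polys \<Phi> ! i) \<and>
     gate_pdepths \<Psi> ! ix i \<le> gate_pdepths \<Phi> ! i + d" if "i < length \<Phi>" for i
    using that
  proof (induction i rule: less_induct)
    case (less i)
    have L: "length \<Gamma> + i < length \<Psi>" using less.prems by (simp add: \<Psi>_def)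
    have G: "\<Psi> ! (length \<Gamma> + i) = redirect_gate \<kappa> ix (\<Phi> ! i)" using less.prems by (simp add: \<Psi>_def nth_append)
    note np = nth_gate_polys[OF wf\<Psi> L, unfolded G] nth_gate_polys[OF wf less.prems]
    note nd = nth_gate_pdepths[OF wf\<Psi> L, unfolded G] nth_gate_pdepths[OF wf less.prems]
    have ch: "j < i" if "j \<in> set (children (\<Phi> ! i))" for j
      using wf less.prems that by (auto simp: well_formed_def)
    have IH: "gate_polys \<Psi> ! ix j = peval (\<lambda>c. Const (\<kappa> c)) s (gate_polys \<Phi> ! j)"
       "gate_pdepths \<Psi> ! ix j \<le> gate_pdepths \<Phi> ! j + d" if "j \<in> set (children (\<Phi> ! i))" for j
      using less.IH[of j] ch[OF that] less.prems by auto
    show ?case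
    proof (cases "\<Phi> ! i")
      case (InVar v)
      then have v: "v \<in> A'" using wf less.prems by (auto simp: well_formed_def)
      have ix: "ix i = \<rho> v" using InVar by (simp add: ix_def redirect_def)
      show ?thesis using \<rho>[OF v] np(2) InVar by (simp add: ix \<Psi>_def nth_fold_gates_append)
    next
      case (InConst c)
      have ix: "ix i = length \<Gamma> + i" using InConst by (simp add: ix_def redirect_def)
      show ?thesis using np nd InConst by (simp add: ix)
    next
      case (Add ws)
      have ix: "ix i = length \<Gamma> + i" using Add by (simp add: ix_def redirect_def)
      have w: "gate_polys \<Psi> ! ix j = peval (\<lambda>c. Const (\<kappa> c)) s (gate_polys \<Phi> ! j)"
         "gate_pdepths \<Psi> ! ix j \<le> gate_pdepths \<Phi> ! j + d" if "(c, j) \<in> set ws" for c j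
        using IH[of j] that Add by force+
      have "gate_polys \<Psi> ! (length \<Gamma> + i) = (\<Sum>(c, j)\<leftarrow>ws. Const (\<kappa> c) * gate_polys \<Psi> ! ix j)"
        using np(1) Add by (simp add: comp_def case_prod_unfold)
      also have "\<dots> = (\<Sum>(c, j)\<leftarrow>ws. peval (\<lambda>c. Const (\<kappa> c)) s (Const c * gate_polys \<Phi> ! j))"
        using w by (auto simp: E.hom_mult intro!: arg_cong[of _ _ sum_list])
      also have "\<dots> = peval (\<lambda>c. Const (\<kappa> c)) s (\<Sum>(c, j)\<leftarrow>ws. Const c * gate_polys \<Phi> ! j)"
        by (simp add: E.hom_sum_list comp_def case_prod_unfold)
      finally have "gate_polys \<Psi> ! ix i = peval (\<lambda>c. Const (\<kappa> c)) s (gate_polys \<Phi> ! i)"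
        using np(2) Add by (simp add: ix)
      moreover have "gate_pdepths \<Psi> ! ix i \<le> gate_pdepths \<Phi> ! i + d"
      proof -
        have "gate_pdepths \<Psi> ! ix j \<le> Max (insert 0 ((\<lambda>(c, i). gate_pdepths \<Phi> ! i) ` set ws)) + d" if "(c, j) \<in> set ws" for c j
        proof -
          have "gate_pdepths \<Phi> ! j \<le> Max (insert 0 ((\<lambda>(c, i). gate_pdepths \<Phi> ! i) ` set ws))"
            by (rule Max_ge) (use that in force)+
          then show ?thesis using w(2)[OF that] by linarith
        qed
        then show ?thesis using nd Add by (auto simp: ix)
      qed
      ultimately show ?thesis ..
    next
      case (Mult js)
      have ix: "ix i = length \<Gamma> + i" using Mult by (simp add: ix_def redirect_def)
      have w: "gate_polys \<Psi> ! ix j = peval (\<lambda>c. Const (\<kappa> c)) s (gate_polys \<Phi> ! j)"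
         "gate_pdepths \<Psi> ! ix j \<le> gate_pdepths \<Phi> ! j + d" if "j \<in> set js" for j
        using IH[of j] that Mult by force+
      have "gate_polys \<Psi> ! (length \<Gamma> + i) = (\<Prod>j\<leftarrow>js. gate_polys \<Psi> ! ix j)"
        using np(1) Mult by (simp add: comp_def)
      also have "\<dots> = (\<Prod>j\<leftarrow>js. peval (\<lambda>c. Const (\<kappa> c)) s (gate_polys \<Phi> ! j))"
        using w by (auto intro!: arg_cong[of _ _ prod_list])
      also have "\<dots> = peval (\<lambda>c. Const (\<kappa> c)) s (\<Prod>j\<leftarrow>js. gate_polys \<Phi> ! j)"
        by (simp add: E.hom_prod_list comp_def)
      finally have "gate_polys \<Psi> ! ix i = peval (\<lambda>c. Const (\<kappa> c)) s (gate_polys \<Phi> ! i)"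
        using np(2) Mult by (simp add: ix)
      moreover have "gate_pdepths \<Psi> ! ix i \<le> gate_pdepths \<Phi> ! i + d"
      proof -
        have "gate_pdepths \<Psi> ! ix j \<le> Max (insert 0 ((\<lambda>i. gate_pdepths \<Phi> ! i) ` set js)) + d" if "j \<in> set js" for j
        proof -
          have "gate_pdepths \<Phi> ! j \<le> Max (insert 0 ((\<lambda>i. gate_pdepths \<Phi> ! i) ` set js))"
            by (rule Max_ge) (use that in force)+
          then show ?thesis using w(2)[OF that] by linarith
        qed
        then show ?thesis using nd Mult by (auto simp: ix)
      qed
      ultimately show ?thesis ..
    qed
  qed
  define l where "l = length \<Phi> - 1"
  have l: "l < length \<Phi>" using ne by (simp add: l_def)
  have last: "circuit_poly \<Phi> = gate_polys \<Phi> ! l" "product_depth \<Phi> = gate_pdepths \<Phi> ! l"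
  proof -
    have "gate_polys \<Phi> \<noteq> []" "gate_pdepths \<Phi> \<noteq> []"
      using ne length_fold_gates by (metis length_0_conv)+
    then show "circuit_poly \<Phi> = gate_polys \<Phi> ! l" "product_depth \<Phi> = gate_pdepths \<Phi> ! l"
      by (simp_all add: circuit_poly_eq product_depth_eq l_def last_conv_nth)
  qed
  have "ix l < length \<Gamma> + length \<Phi>" by (rule ix_le[OF l]) simp
  then have "computed \<Psi> (product_depth \<Phi> + d) (peval (\<lambda>c. Const (\<kappa> c)) s (circuit_poly \<Phi>))"
    unfolding computed_def last using main[OF l] by (intro exI[of _ "ix l"]) (auto simp: \<Psi>_def)
  moreover have "computed \<Psi> (product_depth \<Phi> + d) 1"
    unfolding \<Psi>_def by (rule computed_append, rule computed_mono[OF one]) simp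
  ultimately have "one_gate A \<Psi> (product_depth \<Phi> + d) 2
     (Const a * peval (\<lambda>c. Const (\<kappa> c)) s (circuit_poly \<Phi>) + Const b * 1)"
    by (rule one_gate_lincomb2)
  then obtain G where G: "\<forall>j\<in>set (children G). j < length \<Psi>" "\<forall>v. G = InVar v \<longrightarrow> v \<in> A"
     "gate_poly (gate_polys \<Psi>) G = Const a * peval (\<lambda>c. Const (\<kappa> c)) s (circuit_poly \<Phi>) + Const b"
     "gate_pdepth (gate_pdepths \<Psi>) G \<le> product_depth \<Phi> + d" "length (children G) \<le> 2"
    by (auto simp: one_gate_def)
  have sz: "circuit_size (map (redirect_gate \<kappa> ix) \<Phi> :: ('w, 'd) circuit) = circuit_size \<Phi>"
    by (simp add: circuit_size_def comp_def length_children_redirect_gate)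
  show ?thesis
  proof (intro exI[of _ "\<Psi> @ [G]"] conjI)
    show "circuit_on A (\<Psi> @ [G])" using wf\<Psi> G by (simp add: circuit_on_iff well_formed_snoc)
    show "circuit_size (\<Psi> @ [G]) \<le> circuit_size \<Gamma> + circuit_size \<Phi> + 2"
    proof -
      have "circuit_size [G] \<le> 2" using G(5) by (simp add: circuit_size_def)
      then show ?thesis using sz by (simp add: \<Psi>_def)
    qed
  qed (use G in \<open>simp_all add: circuit_poly_eq product_depth_eq\<close>)
qed

section \<open>The polynomial of a refutation on matrices of low rank\<close>

text \<open>The point at which \<open>X\<close> is \<open>M\<close>, \<open>Y\<close> is the identity, and each placeholder carries the value of
  its equation, except that the placeholders of the determinantal equations are 0.\<close>

fun probe_point :: "'r::comm_ring_1 mat \<Rightarrow> xy_var + 'a eqn \<Rightarrow> 'r" where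
  "probe_point M (Inl (X i j)) = M $$ (i, j)"
| "probe_point M (Inl (Y i j)) = (if i = j then 1 else 0)"
| "probe_point M (Inr (Z E)) = 0"
| "probe_point M (Inr (W i j)) = M $$ (i, j) - (if i = j then 1 else 0)"
| "probe_point M (Inr (U i j)) = M $$ (i, j) * M $$ (i, j) - M $$ (i, j)"
| "probe_point M (Inr (V i j)) = 0"

definition probe :: "('a::comm_ring_1 \<Rightarrow> 'r::comm_ring_1) \<Rightarrow> (xy_var + 'a eqn, 'a) mpoly \<Rightarrow> 'r mat \<Rightarrow> 'r" where
  "probe \<phi> C M = 1 - peval \<phi> (probe_point M) C"

section \<open>Diagonal matrices of prescribed rank\<close>

definition gen_diag :: "nat \<Rightarrow> nat \<Rightarrow> 'r::comm_ring_1 \<Rightarrow> 'r mat" where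
  "gen_diag n s x = mat n n (\<lambda>(i, j). if i = j then (if i < s then 1 else if i = s then x else 0) else 0)"

lemma gen_diag_carrier [simp]: "gen_diag n s x \<in> carrier_mat n n"
  by (simp add: gen_diag_def)

lemma (in comm_ring_hom) map_gen_diag: "map_mat hom (gen_diag n s x) = gen_diag n s (hom x)"
  by (rule eq_matI) (auto simp: gen_diag_def)

lemma gen_diag_full: "n \<ge> 1 \<Longrightarrow> gen_diag n (n - 1) 1 = 1\<^sub>m n"
  by (rule eq_matI) (auto simp: gen_diag_def)

text \<open>Joins the one-parameter families for consecutive \<open>s\<close> into a chain from the
  zero matrix to the identity, on which \<open>critical_rank\<close> uses minimality.\<close>

lemma gen_diag_Suc: "gen_diag n (Suc s) 0 = gen_diag n s 1"
  by (rule eq_matI) (auto simp: gen_diag_def)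

lemma mult_mat_index:
  assumes "A \<in> carrier_mat n1 n2" "B \<in> carrier_mat n2 n3" "i < n1" "j < n3"
  shows "(A * B) $$ (i, j) = (\<Sum>k<n2. A $$ (i, k) * B $$ (k, j))"
  using assms by (auto simp: scalar_prod_def atLeast0LessThan intro!: sum.cong)

lemma gen_diag_mult_index:
  assumes "A \<in> carrier_mat n1 n" "i < n1" "j < n"
  shows "(A * gen_diag n s x) $$ (i, j) = A $$ (i, j) * (if j < s then 1 else if j = s then x else 0)"
proof -
  have "(A * gen_diag n s x) $$ (i, j) = (\<Sum>k<n. A $$ (i, k) * gen_diag n s x $$ (k, j))"
    using assms by (intro mult_mat_index) auto
  also have "\<dots> = (\<Sum>k<n. if k = j then A $$ (i, j) * (if j < s then 1 else if j = s then x else 0) else 0)"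
    by (intro sum.cong) (use assms in \<open>auto simp: gen_diag_def\<close>)
  finally show ?thesis using assms by simp
qed

text \<open>The middle factor kills all columns from \<open>s\<close> on, and \<open>s < r\<close>,
  so both outer factors may be cut to size \<open>r\<close>; the left one then has a zero last
  column. This works over every commutative ring, such as the polynomial rings used below.\<close>

lemma det_rank_deficient:
  assumes A: "A \<in> carrier_mat r n" and B: "B \<in> carrier_mat n r" and "s < r" "r \<le> n"
  shows "det (A * gen_diag n s 0 * B) = 0"
proof -
  define A' where "A' = mat r r (\<lambda>(i, j). (A * gen_diag n s 0) $$ (i, j))"
  define B' where "B' = mat r r (\<lambda>(i, j). B $$ (i, j))"
  have AJ: "A * gen_diag n s 0 \<in> carrier_mat r n" using A by simp
  have A': "A' \<in> carrier_mat r r" and B': "B' \<in> carrier_mat r r" by (auto simp: A'_def B'_def)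
  have "A * gen_diag n s 0 * B = A' * B'"
  proof (rule eq_matI)
    fix i j assume "i < dim_row (A' * B')" "j < dim_col (A' * B')"
    then have ij: "i < r" "j < r" by (auto simp: A'_def B'_def)
    have "(A * gen_diag n s 0 * B) $$ (i, j) = (\<Sum>k<n. (A * gen_diag n s 0) $$ (i, k) * B $$ (k, j))"
      by (rule mult_mat_index[OF AJ B ij])
    also have "\<dots> = (\<Sum>k<r. (A * gen_diag n s 0) $$ (i, k) * B $$ (k, j))"
      by (rule sum.mono_neutral_right) (use assms ij gen_diag_mult_index[OF A ij(1)] in auto)
    also have "\<dots> = (\<Sum>k<r. A' $$ (i, k) * B' $$ (k, j))"
      by (rule sum.cong) (use ij in \<open>auto simp: A'_def B'_def\<close>)
    also have "\<dots> = (A' * B') $$ (i, j)"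
      by (rule mult_mat_index[OF A' B' ij, symmetric])
    finally show "(A * gen_diag n s 0 * B) $$ (i, j) = (A' * B') $$ (i, j)" .
  qed (use A B A' B' in auto)
  moreover have "det A' = 0"
  proof -
    have z: "A' $$ (i, r - 1) = 0" if "i < r" for i
    proof -
      have "(A * gen_diag n s 0) $$ (i, r - 1) = 0"
        using assms that by (subst gen_diag_mult_index[OF A that]) auto
      then show ?thesis using that assms by (simp add: A'_def)
    qed
    have "det A' = (\<Sum>i<r. A' $$ (i, r - 1) * cofactor A' i (r - 1))"
      by (rule laplace_expansion_column[OF A']) (use assms in auto)
    then show ?thesis using z by simp
  qed
  ultimately show ?thesis using det_mult[OF A' B'] by simp
qed

text \<open>The value 0 outside the index range makes the points of two pairs of matrices of equal
  size congruent at every variable as soon as the matrices are congruent.\<close>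

fun gen_point :: "'r::zero mat \<Rightarrow> 'r mat \<Rightarrow> xy_var \<Rightarrow> 'r" where
  "gen_point A B (X i j) = (if i < dim_row A \<and> j < dim_col A then A $$ (i, j) else 0)"
| "gen_point A B (Y i j) = (if i < dim_row B \<and> j < dim_col B then B $$ (i, j) else 0)"

lemma eval_X_mat:
  assumes "comm_ring_hom \<phi>" "A \<in> carrier_mat n n" "B \<in> carrier_mat n n"
  shows "map_mat (peval \<phi> (gen_point A B)) (X_mat n) = A"
    and "map_mat (peval \<phi> (gen_point A B)) (Y_mat n) = B"
proof -
  interpret comm_ring_hom \<phi> by fact
  show "map_mat (peval \<phi> (gen_point A B)) (X_mat n) = A"
    "map_mat (peval \<phi> (gen_point A B)) (Y_mat n) = B"
    using assms by (auto simp: X_mat_def Y_mat_def intro!: eq_matI)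
qed

locale refutation =
  fixes n r :: nat and \<E> :: "'a::field mat set" and C :: "(xy_var + 'a eqn, 'a) mpoly"
  assumes r: "1 \<le> r" "r \<le> n" and carrier: "\<E> \<subseteq> carrier_mat r n"
    and ips: "ips_refutation (X_vars n \<union> Y_vars n) (sys_eqns n \<E>) (sys_poly n) C"
begin

lemma vars_cases:
  assumes "v \<in> mpoly_vars C"
  obtains i j where "v = Inl (X i j)" "i < n" "j < n"
  | i j where "v = Inl (Y i j)" "i < n" "j < n"
  | E where "v = Inr (Z E)" "E \<in> \<E>"
  | i j where "v = Inr (W i j)" "i < n" "j < n"
  | i j where "v = Inr (U i j)" "i < n" "j < n"
  | i j where "v = Inr (V i j)" "i < n" "j < n"
proof -
  have "v \<in> ips_vars (X_vars n \<union> Y_vars n) (sys_eqns n \<E>)"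
    using ips assms by (auto simp: ips_refutation_def)
  then show thesis
    by (auto simp: ips_vars_def X_vars_def Y_vars_def sys_eqns_def intro: that)
qed

lemma hom_probe:
  assumes "comm_ring_hom \<psi>" "M \<in> carrier_mat n n"
  shows "\<psi> (probe \<phi> C M) = probe (\<lambda>c. \<psi> (\<phi> c)) C (map_mat \<psi> M)"
proof -
  interpret comm_ring_hom \<psi> by fact
  have "peval (\<lambda>c. \<psi> (\<phi> c)) (\<lambda>v. \<psi> (probe_point M v)) C = peval (\<lambda>c. \<psi> (\<phi> c)) (probe_point (map_mat \<psi> M)) C"
  proof (rule peval_cong)
    fix v assume "v \<in> mpoly_vars C"
    then show "\<psi> (probe_point M v) = probe_point (map_mat \<psi> M) v"
      by (cases rule: vars_cases) (use assms(2) in \<open>auto simp: hom_minus hom_mult\<close>)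
  qed
  then show ?thesis by (simp add: probe_def hom_minus peval_hom[OF assms(1)])
qed

text \<open>At the identity the placeholders \<open>W\<close> and \<open>U\<close> vanish as well,
  since \<open>M - 1 = 0\<close> and the entries 0 and 1 are idempotent.\<close>

lemma probe_one:
  assumes "comm_ring_hom \<phi>"
  shows "probe \<phi> C (1\<^sub>m n) = 1"
proof -
  interpret comm_ring_hom \<phi> by fact
  let ?a = "gen_point (1\<^sub>m n) (1\<^sub>m n)"
  have "peval \<phi> (probe_point (1\<^sub>m n)) C = peval \<phi> (\<lambda>v. peval \<phi> ?a (case_sum Var (\<lambda>_. 0) v)) C"
  proof (rule peval_cong)
    fix v assume "v \<in> mpoly_vars C"
    then show "probe_point (1\<^sub>m n) v = peval \<phi> ?a (case_sum Var (\<lambda>_. 0) v)"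
      by (cases rule: vars_cases) auto
  qed
  also have "\<dots> = peval \<phi> ?a (mpoly_subst (case_sum Var (\<lambda>_. 0)) C)"
    by (simp add: peval_mpoly_subst[OF assms])
  also have "\<dots> = 0" using ips by (simp add: ips_refutation_def)
  finally show ?thesis by (simp add: probe_def)
qed

lemma probe_rank_deficient:
  assumes "comm_ring_hom \<phi>" and A: "A \<in> carrier_mat n n" and B: "B \<in> carrier_mat n n" and "s < r"
  shows "probe \<phi> C (A * gen_diag n s 0 * B) = 0"
proof -
  interpret comm_ring_hom \<phi> by fact
  define M where "M = A * gen_diag n s 0 * B"
  have M: "M \<in> carrier_mat n n" using A B unfolding M_def by (intro mult_carrier_mat[of _ n n]) auto
  let ?a = "gen_point M (1\<^sub>m n)"
  interpret P: comm_ring_hom "peval \<phi> ?a" by (rule comm_ring_hom_peval)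
  have evX: "map_mat (peval \<phi> ?a) (X_mat n) = M" "map_mat (peval \<phi> ?a) (Y_mat n) = 1\<^sub>m n"
    using eval_X_mat[OF assms(1) M] by auto
  have "peval \<phi> (probe_point M) C = peval \<phi> (\<lambda>v. peval \<phi> ?a (case_sum Var (sys_poly n) v)) C"
  proof (rule peval_cong)
    fix v assume "v \<in> mpoly_vars C"
    then show "probe_point M v = peval \<phi> ?a (case_sum Var (sys_poly n) v)"
    proof (cases rule: vars_cases)
      \<comment> \<open>Here the low rank enters: the probe point has 0 for this placeholder, and
        the determinant is 0 because the product passes through the truncated diagonal
        matrix.\<close>
      case (3 E)
      let ?E = "map_mat \<phi> E"
      have E: "E \<in> carrier_mat r n" using 3 carrier by auto
      then have E': "?E \<in> carrier_mat r n" by simp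
      have X: "X_mat n \<in> carrier_mat n n" by (simp add: X_mat_def)
      have cE: "map_mat Const E \<in> carrier_mat r n" using E by simp
      have m: "map_mat (peval \<phi> ?a) (map_mat Const E) = ?E"
        by (rule eq_matI) auto
      have "map_mat (peval \<phi> ?a) (map_mat Const E * X_mat n * transpose_mat (map_mat Const E)) =
        ?E * M * transpose_mat ?E"
        using P.mat_hom_mult[OF mult_carrier_mat[OF cE X], of "transpose_mat (map_mat Const E)" r]
          P.mat_hom_mult[OF cE X] cE by (simp add: evX m map_mat_transpose[symmetric])
      then have "peval \<phi> ?a (sys_poly n (Z E)) = det (?E * M * transpose_mat ?E)"
        by (metis P.hom_det sys_poly.simps(1))
      also have "?E * M * transpose_mat ?E = (?E * A) * gen_diag n s 0 * (B * transpose_mat ?E)"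
      proof -
        have AJ: "A * gen_diag n s 0 \<in> carrier_mat n n" using A by simp
        have T: "transpose_mat ?E \<in> carrier_mat n r" using E' by simp
        have BT: "B * transpose_mat ?E \<in> carrier_mat n r" using B T by simp
        have "?E * M * transpose_mat ?E = ?E * (A * gen_diag n s 0 * (B * transpose_mat ?E))"
          unfolding assoc_mult_mat[OF E' M T] unfolding M_def assoc_mult_mat[OF AJ B T] ..
        also have "\<dots> = ?E * (A * gen_diag n s 0) * (B * transpose_mat ?E)"
          by (rule assoc_mult_mat[OF E' AJ BT, symmetric])
        also have "?E * (A * gen_diag n s 0) = (?E * A) * gen_diag n s 0"
          by (rule assoc_mult_mat[OF E' A gen_diag_carrier, symmetric])
        finally show ?thesis .
      qed
      also have "det \<dots> = 0"
        by (rule det_rank_deficient) (use A B E' assms r in auto)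
      finally show ?thesis using 3 by simp
    next
      case (4 i j)
      have "peval \<phi> ?a ((X_mat n * Y_mat n) $$ (i, j)) = (M * 1\<^sub>m n) $$ (i, j)"
      proof -
        have XY: "(X_mat n :: (xy_var, 'a) mpoly mat) \<in> carrier_mat n n" "(Y_mat n :: (xy_var, 'a) mpoly mat) \<in> carrier_mat n n"
          by (auto simp: X_mat_def Y_mat_def)
        have "map_mat (peval \<phi> ?a) (X_mat n * Y_mat n) = M * 1\<^sub>m n"
          using P.mat_hom_mult[OF XY] by (simp only: evX)
        then have "map_mat (peval \<phi> ?a) (X_mat n * Y_mat n) $$ (i, j) = (M * 1\<^sub>m n) $$ (i, j)"
          by (rule arg_cong)
        then show ?thesis using 4 XY by (subst (asm) index_map_mat) auto
      qed
      then show ?thesis using 4 M by (simp add: P.hom_minus X_mat_def Y_mat_def)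
    qed (use M in \<open>auto simp: P.hom_minus P.hom_mult hadamard_def X_mat_def Y_mat_def\<close>)
  qed
  also have "\<dots> = peval \<phi> ?a (mpoly_subst (case_sum Var (sys_poly n)) C)"
    by (simp add: peval_mpoly_subst[OF assms(1)])
  also have "\<dots> = 1" using ips by (simp add: ips_refutation_def)
  finally show ?thesis by (simp add: probe_def M_def)
qed

text \<open>Take the least \<open>s\<close> for which the generic probe is nonzero at
  \<open>x = 1\<close>. It exists because for \<open>s = n - 1\<close> the specialization
  \<open>P = Q = 1\<close> gives the identity, where the probe is 1. It is at least
  \<open>r - 1\<close> because smaller \<open>s\<close> give rank below \<open>r\<close>.\<close>

lemma critical_rank:
  defines "P \<equiv> X_mat n :: (xy_var, 'a) mpoly mat" and "Q \<equiv> Y_mat n"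
  shows "\<exists>s<n. r \<le> Suc s \<and> probe Const C (P * gen_diag n s 1 * Q) \<noteq> 0 \<and>
     probe Const C (P * gen_diag n s 0 * Q) = 0"
proof -
  have PQ: "P \<in> carrier_mat n n" "Q \<in> carrier_mat n n" by (auto simp: P_def Q_def X_mat_def Y_mat_def)
  have hC: "comm_ring_hom (Const :: 'a \<Rightarrow> (xy_var, 'a) mpoly)" by (rule comm_ring_hom_Const)
  have hid: "comm_ring_hom (\<lambda>c::'a. c)" by unfold_locales auto
  let ?ev = "peval (\<lambda>c::'a. c) (gen_point (1\<^sub>m n) (1\<^sub>m n))"
  interpret ev: comm_ring_hom ?ev by (rule comm_ring_hom.comm_ring_hom_peval[OF hid])
  define bad where "bad s \<longleftrightarrow> probe Const C (P * gen_diag n s 1 * Q) \<noteq> 0" for s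
  have "bad (n - 1)"
    unfolding bad_def
  proof
    assume 0: "probe Const C (P * gen_diag n (n - 1) 1 * Q) = 0"
    have "P * gen_diag n (n - 1) 1 * Q = P * Q" using r PQ by (subst gen_diag_full) auto
    then have "0 = ?ev (probe Const C (P * Q))" using 0 by simp
    also have "\<dots> = probe (\<lambda>c. ?ev (Const c)) C (map_mat ?ev (P * Q))"
      by (rule hom_probe[OF ev.comm_ring_hom_axioms]) (use PQ in auto)
    also have "map_mat ?ev (P * Q) = 1\<^sub>m n"
      using eval_X_mat[OF hid, of "1\<^sub>m n" n "1\<^sub>m n"] PQ by (simp add: ev.mat_hom_mult P_def Q_def)
    also have "(\<lambda>c. ?ev (Const c)) = (\<lambda>c. c)"
      using comm_ring_hom.peval_Const[OF hid] by auto
    also have "probe (\<lambda>c. c) C (1\<^sub>m n) = 1" by (rule probe_one[OF hid])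
    finally show False by simp
  qed
  define s where "s = (LEAST s. bad s)"
  have s: "bad s" "s \<le> n - 1"
    using \<open>bad (n - 1)\<close> by (auto simp: s_def intro: LeastI Least_le)
  have "r \<le> Suc s"
  proof (rule ccontr)
    assume "\<not> r \<le> Suc s"
    then have "probe Const C (P * gen_diag n (Suc s) 0 * Q) = 0"
      by (intro probe_rank_deficient[OF hC PQ]) auto
    with s show False by (simp add: bad_def gen_diag_Suc)
  qed
  \<comment> \<open>The value at \<open>x = 0\<close> is the value at \<open>x = 1\<close> for
    \<open>s - 1\<close>, which vanishes by minimality; for \<open>s = 0\<close> the matrix is zero,
    and \<open>r \<ge> 1\<close>.\<close>
  moreover have "probe Const C (P * gen_diag n s 0 * Q) = 0"
  proof (cases s)
    case 0
    then show ?thesis using r by (intro probe_rank_deficient[OF hC PQ]) auto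
  next
    case (Suc s')
    then have "\<not> bad s'" using not_less_Least[of s' bad] by (simp add: s_def)
    then show ?thesis by (simp add: Suc gen_diag_Suc bad_def)
  qed
  ultimately show ?thesis using s r unfolding bad_def by (intro exI[of _ s]) auto
qed

text \<open>Polynomials in \<open>x\<close> over the polynomials in the entries of \<open>P\<close>
  and \<open>Q\<close> are universal for such probes: specializing \<open>P\<close>,
  \<open>Q\<close> and \<open>x\<close> is a homomorphism out of this ring.\<close>

lemma hom_probe_generic:
  fixes hom :: "(xy_var, 'a) mpoly poly \<Rightarrow> 'r::comm_ring_1"
  assumes "comm_ring_hom hom"
  shows "hom (probe (\<lambda>c. [:Const c:]) C
      (map_mat (\<lambda>p. [:p:]) (X_mat n) * gen_diag n s [:0, 1:] * map_mat (\<lambda>p. [:p:]) (Y_mat n))) =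
    probe (\<lambda>c. hom [:Const c:]) C (map_mat (\<lambda>p. hom [:p:]) (X_mat n) * gen_diag n s (hom [:0, 1:]) *
      map_mat (\<lambda>p. hom [:p:]) (Y_mat n))"
proof -
  interpret comm_ring_hom hom by fact
  let ?P = "map_mat (\<lambda>p::(xy_var, 'a) mpoly. [:p:]) (X_mat n)" and ?Q = "map_mat (\<lambda>p::(xy_var, 'a) mpoly. [:p:]) (Y_mat n)"
  have PQ: "?P \<in> carrier_mat n n" "?Q \<in> carrier_mat n n" by (auto simp: X_mat_def Y_mat_def)
  then have PJ: "?P * gen_diag n s [:0, 1:] \<in> carrier_mat n n" by simp
  have comp: "map_mat hom (map_mat (\<lambda>p. [:p:]) A) = map_mat (\<lambda>p. hom [:p:]) A" for A
    by (rule eq_matI) auto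
  have "map_mat hom (?P * gen_diag n s [:0, 1:] * ?Q) = map_mat hom ?P * gen_diag n s (hom [:0, 1:]) * map_mat hom ?Q"
    using mat_hom_mult[OF PJ PQ(2)] mat_hom_mult[OF PQ(1) gen_diag_carrier] by (simp add: map_gen_diag)
  then show ?thesis
    by (subst hom_probe[OF assms]) (use PJ PQ in \<open>auto simp: comp\<close>)
qed

text \<open>As a polynomial in \<open>x\<close>, \<open>probe (P * gen_diag n s x * Q)\<close> with generic \<open>P\<close> and \<open>Q\<close> has
  lowest term \<open>h * x ^ k\<close>.\<close>

lemma probe_lowest_term:
  fixes \<phi> :: "'a \<Rightarrow> 'r::comm_ring_1"
  assumes \<phi>: "comm_ring_hom \<phi>"
  shows "\<exists>s k h. s < n \<and> r \<le> Suc s \<and> 1 \<le> k \<and> h \<noteq> 0 \<and>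
    peval Const (gen_point (X_mat n) (Y_mat n)) h = h \<and>
    (\<forall>A\<in>carrier_mat n n. \<forall>B\<in>carrier_mat n n. \<forall>x. \<exists>c.
       probe \<phi> C (A * gen_diag n s x * B) = x ^ k * (peval \<phi> (gen_point A B) h + x * c))"
proof -
  define P where "P = (X_mat n :: (xy_var, 'a) mpoly mat)"
  define Q where "Q = (Y_mat n :: (xy_var, 'a) mpoly mat)"
  have PQ: "P \<in> carrier_mat n n" "Q \<in> carrier_mat n n" by (auto simp: P_def Q_def X_mat_def Y_mat_def)
  obtain s where s: "s < n" "r \<le> Suc s" "probe Const C (P * gen_diag n s 1 * Q) \<noteq> 0"
     "probe Const C (P * gen_diag n s 0 * Q) = 0"
    using critical_rank by (auto simp: P_def Q_def)
  let ?p = "\<lambda>p::(xy_var, 'a) mpoly. [:p:]"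
  define M where "M = map_mat ?p P * gen_diag n s [:0, 1:] * map_mat ?p Q"
  have M: "M \<in> carrier_mat n n" using PQ unfolding M_def by (intro mult_carrier_mat[of _ n n]) auto
  define H where "H = probe (\<lambda>c. ?p (Const c)) C M"
  note eval = hom_probe_generic[folded P_def Q_def, of _ s, folded M_def, folded H_def]
  have ev: "poly H x = probe Const C (P * gen_diag n s x * Q)" for x
  proof -
    have "comm_ring_hom (\<lambda>p. poly p x)" by unfold_locales auto
    moreover have "map_mat (\<lambda>p. p) A = A" for A :: "(xy_var, 'a) mpoly mat" by (rule eq_matI) auto
    ultimately show ?thesis using eval[of "\<lambda>p. poly p x"] by simp
  qed
  have H0: "coeff H 0 = 0" using ev[of 0] s(4) by (simp add: poly_0_coeff_0)
  have "H \<noteq> 0" using ev[of 1] s(3) by auto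
  then have ex: "\<exists>j. coeff H j \<noteq> 0" by (metis leading_coeff_0_iff)
  define k where "k = (LEAST j. coeff H j \<noteq> 0)"
  have k: "coeff H k \<noteq> 0" "\<And>j. j < k \<Longrightarrow> coeff H j = 0"
    using LeastI_ex[OF ex] not_less_Least by (auto simp: k_def)
  have "k \<ge> 1" using k(1) H0 by (cases k) auto
  have "monom 1 k dvd H" using k(2) by (simp add: monom_1_dvd_iff')
  then obtain H' where H': "H = monom 1 k * H'" by (rule dvdE)
  obtain h H'' where H'': "H' = pCons h H''" by (cases H')
  have "coeff H k = coeff H' 0" by (simp add: H' coeff_monom_mult)
  also have "\<dots> = h" by (simp add: H'')
  finally have "coeff H k = h" .
  with k have h: "h \<noteq> 0" by simp
  have "\<exists>c. probe \<phi> C (A * gen_diag n s x * B) = x ^ k * (peval \<phi> (gen_point A B) h + x * c)"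
    if A: "A \<in> carrier_mat n n" and B: "B \<in> carrier_mat n n" for A B and x :: 'r
  proof -
    let ?\<theta> = "peval \<phi> (gen_point A B)"
    interpret \<phi>: comm_ring_hom \<phi> by fact
    interpret \<theta>: comm_ring_hom ?\<theta> by (rule \<phi>.comm_ring_hom_peval)
    interpret m: map_poly_comm_ring_hom ?\<theta> ..
    have hom: "comm_ring_hom (\<lambda>p. poly (map_poly ?\<theta> p) x)"
      by unfold_locales (auto simp: m.hom_add m.hom_mult)
    have "poly (map_poly ?\<theta> H) x = probe \<phi> C (map_mat ?\<theta> P * gen_diag n s x * map_mat ?\<theta> Q)"
      using eval[OF hom] by (simp add: \<theta>.map_poly_pCons_hom)
    then have "probe \<phi> C (A * gen_diag n s x * B) = poly (map_poly ?\<theta> H) x"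
      using eval_X_mat[OF \<phi> A B] by (simp add: P_def Q_def)
    also have "\<dots> = x ^ k * (?\<theta> h + x * poly (map_poly ?\<theta> H'') x)"
      unfolding H' m.hom_mult poly_mult H'' \<theta>.map_poly_pCons_hom by (simp add: poly_monom)
    finally show ?thesis ..
  qed
  \<comment> \<open>Records that \<open>h\<close> involves only variables with indices below
    \<open>n\<close>, as \<open>gen_point P Q\<close> sends all others to 0. It holds because the
    generic probe itself is fixed by this substitution.\<close>
  moreover have "peval Const (gen_point P Q) h = h"
  proof -
    let ?\<theta> = "peval (Const :: 'a \<Rightarrow> (xy_var, 'a) mpoly) (gen_point P Q)"
    interpret \<theta>: comm_ring_hom ?\<theta>
      by (rule comm_ring_hom.comm_ring_hom_peval[OF comm_ring_hom_Const])
    interpret m: map_poly_comm_ring_hom ?\<theta> ..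
    have fixed: "map_mat ?\<theta> P = P" "map_mat ?\<theta> Q = Q"
      using eval_X_mat[OF comm_ring_hom_Const PQ] by (simp_all add: P_def Q_def)
    have split: "map_mat (\<lambda>p. [:?\<theta> p:]) A = map_mat ?p (map_mat ?\<theta> A)" for A
      by (rule eq_matI) auto
    have "?\<theta> (Const c) = Const c" for c
      using comm_ring_hom.peval_Const[OF comm_ring_hom_Const] by auto
    then have "map_poly ?\<theta> H = H"
      unfolding eval[OF m.comm_ring_hom_axioms]
      by (simp add: \<theta>.map_poly_pCons_hom split fixed H_def M_def)
    then have "coeff (map_poly ?\<theta> H) k = coeff H k" by simp
    then show ?thesis using \<open>coeff H k = h\<close> by simp
  qed
  ultimately show ?thesis using s h \<open>k \<ge> 1\<close> unfolding P_def Q_def by blast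
qed

end

section \<open>Degeneration to the determinant\<close>

definition affine_in :: "'v set \<Rightarrow> ('v, 'c::comm_ring_1) mpoly \<Rightarrow> bool" where
  "affine_in A p \<longleftrightarrow> (\<exists>a0 a. p = Const a0 + (\<Sum>v\<in>A. Const (a v) * Var v))"

lemma Const_simps:
  "Const 0 = 0" "Const 1 = 1" "Const (a + b) = Const a + Const b" "Const (a * b) = Const a * Const b"
  "Const (- a) = - Const a" "Const (a - b) = Const a - Const b" "Const (a ^ k) = Const a ^ k"
proof -
  interpret comm_ring_hom Const by (rule comm_ring_hom_Const)
  show "Const 0 = 0" "Const 1 = 1" "Const (a + b) = Const a + Const b" "Const (a * b) = Const a * Const b"
    "Const (- a) = - Const a" "Const (a - b) = Const a - Const b" "Const (a ^ k) = Const a ^ k"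
    by (simp_all add: hom_add hom_mult hom_uminus hom_minus hom_power)
qed

lemma affine_in_Const: "affine_in A (Const c)"
  unfolding affine_in_def by (rule exI[of _ c], rule exI[of _ "\<lambda>_. 0"]) (simp add: Const_simps)

lemma affine_in_Var:
  assumes "finite A" "v \<in> A" shows "affine_in A (Var v :: ('v, 'c::comm_ring_1) mpoly)"
proof -
  have "(\<Sum>w\<in>A. Const (if w = v then 1 else 0) * Var w :: ('v, 'c) mpoly) = (\<Sum>w\<in>A. if w = v then Var v else 0)"
    by (rule sum.cong) (auto simp: Const_simps)
  also have "\<dots> = Var v" using assms by simp
  finally show ?thesis
    unfolding affine_in_def
    by (intro exI[of _ 0] exI[of _ "\<lambda>w. if w = v then 1 else 0"]) (simp add: Const_simps)
qed

lemma affine_in_add: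
  assumes "affine_in A p" "affine_in A q" shows "affine_in A (p + q)"
proof -
  obtain a0 a b0 b where p: "p = Const a0 + (\<Sum>v\<in>A. Const (a v) * Var v)" and q: "q = Const b0 + (\<Sum>v\<in>A. Const (b v) * Var v)"
    using assms unfolding affine_in_def by blast
  have "p + q = Const (a0 + b0) + (\<Sum>v\<in>A. Const (a v + b v) * Var v)"
    by (simp add: p q Const_simps distrib_right sum.distrib algebra_simps)
  then show ?thesis unfolding affine_in_def by (intro exI)
qed

lemma affine_in_Const_mult:
  assumes "affine_in A p" shows "affine_in A (Const c * p)"
proof -
  obtain a0 a where p: "p = Const a0 + (\<Sum>v\<in>A. Const (a v) * Var v)"
    using assms unfolding affine_in_def by blast
  have "Const c * p = Const (c * a0) + (\<Sum>v\<in>A. Const (c * a v) * Var v)"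
    by (simp add: p Const_simps distrib_left sum_distrib_left mult.assoc)
  then show ?thesis unfolding affine_in_def by (intro exI)
qed

lemma affine_in_mult_Const: "affine_in A p \<Longrightarrow> affine_in A (p * Const c)"
  using affine_in_Const_mult by (metis mult.commute)

lemma affine_in_uminus: "affine_in A p \<Longrightarrow> affine_in A (- p)"
  using affine_in_Const_mult[of A p "- 1"] by (simp add: Const_simps)

lemma affine_in_diff: "affine_in A p \<Longrightarrow> affine_in A q \<Longrightarrow> affine_in A (p - q)"
  using affine_in_add[of A p "- q"] affine_in_uminus by auto

lemma affine_in_0_1: "affine_in A 0" "affine_in A 1"
  using affine_in_Const[of A 0] affine_in_Const[of A 1] by (simp_all add: Const_simps)

lemma affine_in_sum: "(\<And>i. i \<in> I \<Longrightarrow> affine_in A (f i)) \<Longrightarrow> affine_in A (\<Sum>i\<in>I. f i)"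
  by (induction I rule: infinite_finite_induct) (auto simp: affine_in_0_1 intro: affine_in_add)

section \<open>The lowest nonconstant term of a power of \<open>1 + y\<close>\<close>

lemma one_plus_power_expansion:
  fixes y :: "'r::comm_ring_1"
  shows "\<exists>c. (1 + y) ^ k = 1 + of_nat k * y + y ^ 2 * c"
proof (induction k)
  case 0
  show ?case by (rule exI[of _ 0]) simp
next
  case (Suc k)
  then obtain c where "(1 + y) ^ k = 1 + of_nat k * y + y ^ 2 * c" by blast
  then have "(1 + y) ^ Suc k = 1 + of_nat (Suc k) * y + y ^ 2 * (of_nat k + c + y * c)"
    by (simp add: algebra_simps power2_eq_square)
  then show ?case by blast
qed

text \<open>In characteristic 0 the linear term \<open>k * y\<close> survives. In characteristic
  \<open>p\<close> write \<open>k = q * k0\<close> with \<open>q\<close> a power of \<open>p\<close>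
  and \<open>k0\<close> prime to \<open>p\<close>; then
  \<open>(1 + y) ^ k = (1 + y ^ q) ^ k0\<close> begins with \<open>1 + k0 * y ^ q\<close>.\<close>

lemma one_plus_power_lowest_term_poly:
  assumes "k \<ge> 1"
  shows "\<exists>q (k' :: 'a::field) p. k' \<noteq> 0 \<and> (CHAR('a) = 0 \<longrightarrow> q = 1) \<and> (CHAR('a) > 0 \<longrightarrow> (\<exists>j. q = CHAR('a) ^ j)) \<and>
    [:1, 1:] ^ k = 1 + [:k':] * [:0, 1:] ^ q + [:0, 1:] ^ (q + 1) * p"
proof -
  have of_nat_poly': "of_nat m = [:of_nat m :: 'a:]" for m by (simp add: of_nat_poly)
  have lin: "[:1, 1:] = 1 + [:0, 1 :: 'a:]" by (simp add: one_pCons)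
  show ?thesis
  proof (cases "CHAR('a) = 0")
    case True
    obtain c where "(1 + [:0, 1 :: 'a:]) ^ k = 1 + of_nat k * [:0, 1:] + [:0, 1:] ^ 2 * c"
      using one_plus_power_expansion by blast
    moreover have "(of_nat k :: 'a) \<noteq> 0" using True assms by (simp add: of_nat_eq_0_iff_char_dvd)
    ultimately show ?thesis using True
      by (intro exI[of _ 1] exI[of _ "of_nat k"] exI[of _ c]) (auto simp: lin of_nat_poly' numeral_2_eq_2)
  next
    case False
    then have prime: "prime CHAR('a)" using prime_CHAR_semidom by auto
    obtain k0 where k0: "k = CHAR('a) ^ multiplicity CHAR('a) k * k0" "\<not> CHAR('a) dvd k0"
      using multiplicity_decompose'[of k "CHAR('a)"] assms prime by (metis not_one_le_zero not_prime_unit)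
    define q where "q = CHAR('a) ^ multiplicity CHAR('a) k"
    have "q \<ge> 1" using False by (simp add: q_def Suc_le_eq)
    have "(1 + [:0, 1 :: 'a:]) ^ q = 1 + [:0, 1:] ^ q"
      using freshmans_dream'[of q "multiplicity CHAR('a) k" "1 :: 'a poly" "[:0, 1:]"] prime by (simp add: q_def)
    moreover obtain c where c: "(1 + [:0, 1 :: 'a:] ^ q) ^ k0 = 1 + of_nat k0 * [:0, 1:] ^ q + ([:0, 1:] ^ q) ^ 2 * c"
      using one_plus_power_expansion by blast
    ultimately have "[:1, 1 :: 'a:] ^ k = 1 + of_nat k0 * [:0, 1:] ^ q + ([:0, 1:] ^ q) ^ 2 * c"
      using k0(1)[folded q_def] by (metis lin power_mult)
    \<comment> \<open>As \<open>q \<ge> 1\<close>, degree \<open>2 * q\<close> is at least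
      \<open>q + 1\<close>, so the quadratic remainder fits the stated error term.\<close>
    also have "([:0, 1 :: 'a:] ^ q) ^ 2 = [:0, 1:] ^ (q + 1) * [:0, 1:] ^ (q - 1)"
    proof -
      have "q * 2 = (q + 1) + (q - 1)" using \<open>q \<ge> 1\<close> by simp
      then show ?thesis by (simp only: power_mult[symmetric] power_add[symmetric])
    qed
    finally have "[:1, 1 :: 'a:] ^ k = 1 + [:of_nat k0:] * [:0, 1:] ^ q + [:0, 1:] ^ (q + 1) * ([:0, 1:] ^ (q - 1) * c)"
      by (simp only: of_nat_poly' mult.assoc)
    moreover have "(of_nat k0 :: 'a) \<noteq> 0" using k0(2) by (simp add: of_nat_eq_0_iff_char_dvd)
    ultimately show ?thesis
      by (intro exI[of _ q] exI[of _ "of_nat k0"] exI[of _ "[:0, 1:] ^ (q - 1) * c"] conjI)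
        (use False in \<open>auto simp: q_def\<close>)
  qed
qed

text \<open>Evaluates the polynomial identity at \<open>y\<close>; thus \<open>q\<close> and
  \<open>k'\<close> are fixed before \<open>y\<close>.\<close>

lemma one_plus_power_lowest_term:
  fixes \<phi> :: "'a::field \<Rightarrow> 'r::comm_ring_1"
  assumes "comm_ring_hom \<phi>" "k \<ge> 1"
  shows "\<exists>q k'. k' \<noteq> 0 \<and> (CHAR('a) = 0 \<longrightarrow> q = 1) \<and> (CHAR('a) > 0 \<longrightarrow> (\<exists>j. q = CHAR('a) ^ j)) \<and>
    (\<forall>y. \<exists>c. (1 + y) ^ k = 1 + \<phi> k' * y ^ q + y ^ (q + 1) * c)"
proof -
  obtain q k' p where q: "k' \<noteq> 0" "CHAR('a) = 0 \<longrightarrow> q = 1" "CHAR('a) > 0 \<longrightarrow> (\<exists>j. q = CHAR('a) ^ j)"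
    and p: "[:1, 1 :: 'a:] ^ k = 1 + [:k':] * [:0, 1:] ^ q + [:0, 1:] ^ (q + 1) * p"
    using one_plus_power_lowest_term_poly[OF assms(2), where 'a = 'a] by (elim exE conjE) (rule that)
  interpret \<phi>: comm_ring_hom \<phi> by fact
  interpret m: map_poly_comm_ring_hom \<phi> ..
  have "\<exists>c. (1 + y) ^ k = 1 + \<phi> k' * y ^ q + y ^ (q + 1) * c" for y
  proof -
    define ev where "ev p = poly (map_poly \<phi> p) y" for p
    have "comm_ring_hom ev" by unfold_locales (auto simp: ev_def m.hom_add m.hom_mult)
    then interpret ev: comm_ring_hom ev .
    have evs: "ev [:1, 1:] = 1 + y" "ev [:k':] = \<phi> k'" "ev [:0, 1:] = y"
      by (simp_all add: ev_def \<phi>.map_poly_pCons_hom)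
    have "ev ([:1, 1:] ^ k) = ev (1 + [:k':] * [:0, 1:] ^ q + [:0, 1:] ^ (q + 1) * p)"
      by (simp only: p)
    then have "(1 + y) ^ k = 1 + \<phi> k' * y ^ q + y ^ (q + 1) * ev p"
      by (simp only: ev.hom_add ev.hom_mult ev.hom_power ev.hom_one evs)
    then show ?thesis ..
  qed
  with q show ?thesis by (intro exI[of _ q] exI[of _ k'] conjI allI)
qed

text \<open>A bordered unitriangular matrix: its Schur complement sums the weights of all paths. The powers
  of \<open>e\<close> on an edge from \<open>i\<close> to \<open>j\<close> are proportional to \<open>j - i\<close>, so that all paths are scaled alike.\<close>

lemma bordered_factorization:
  fixes N :: nat and e d :: "'r::comm_ring_1" and x c :: "nat \<Rightarrow> 'r" and B :: "nat \<Rightarrow> nat \<Rightarrow> 'r"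
  assumes x0: "x 0 = 1" and rec: "\<And>j. j \<ge> 1 \<Longrightarrow> x j = (\<Sum>i<j. x i * B i j)" and m: "m \<le> s" "s < n"
  defines "L \<equiv> mat n n (\<lambda>(i, j).
      if i < s \<and> j < s then (if i = j then 1 else 0) - (if i < j then e ^ (N * (j - i)) * B i j else 0)
      else if i < s \<and> j = s then (if i < m then - (e ^ (N * (s - i)) * c i) else 0)
      else if i = s \<and> j < s then (if j = 0 then e ^ N else 0)
      else if i = s \<and> j = s then d else 0)"
  shows "\<exists>Lo Up. Lo \<in> carrier_mat n n \<and> Up \<in> carrier_mat n n \<and>
     (\<forall>i<n. \<forall>j<n. e ^ N dvd Lo $$ (i, j) - 1\<^sub>m n $$ (i, j) \<and> e ^ N dvd Up $$ (i, j) - 1\<^sub>m n $$ (i, j)) \<and>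
     L = Lo * gen_diag n s (d + e ^ (N * (s + 1)) * (\<Sum>i<m. x i * c i)) * Up"
proof -
  define \<sigma> where "\<sigma> = d + e ^ (N * (s + 1)) * (\<Sum>i<m. x i * c i)"
  \<comment> \<open>\<open>u\<close> solves \<open>u * T = (e ^ N, 0, ..., 0)\<close> for the
    unitriangular block \<open>T\<close> of \<open>L\<close>: column \<open>j\<close> of this system
    is the recursion for \<open>x\<close>, as the exponents \<open>k + 1\<close> and
    \<open>j - k\<close> add up to \<open>j + 1\<close>. Row \<open>s\<close> of \<open>Lo\<close>
    therefore eliminates row \<open>s\<close> of \<open>L\<close> and leaves the Schur complement
    \<open>\<sigma>\<close>.\<close>
  define u where "u j = e ^ (N * (j + 1)) * x j" for j
  define Lo where "Lo = mat n n (\<lambda>(i, j). if i = s \<and> j < s then u j else if i = j then 1 else 0)"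
  define Up where "Up = mat n n (\<lambda>(i, j). if i < s \<and> j \<le> s then L $$ (i, j) else if i = j then 1 else 0)"
  have c: "Lo \<in> carrier_mat n n" "Up \<in> carrier_mat n n" by (auto simp: Lo_def Up_def)
  \<comment> \<open>Off the diagonal every exponent is a positive multiple of \<open>N\<close>, so
    both factors are the identity modulo \<open>e ^ N\<close>.\<close>
  have dvd_pow: "e ^ N dvd e ^ (N * k)" if "k \<ge> 1" for k
    using that by (intro le_imp_power_dvd) (cases k, auto)
  have dvd: "e ^ N dvd Lo $$ (i, j) - 1\<^sub>m n $$ (i, j) \<and> e ^ N dvd Up $$ (i, j) - 1\<^sub>m n $$ (i, j)" if "i < n" "j < n" for i j
    using that m dvd_pow[of "Suc j"] by (auto simp: Lo_def Up_def L_def u_def intro!: dvd_mult2 dvd_pow)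
  have "L = Lo * gen_diag n s \<sigma> * Up"
  proof (rule eq_matI)
    fix i j assume "i < dim_row (Lo * gen_diag n s \<sigma> * Up)" "j < dim_col (Lo * gen_diag n s \<sigma> * Up)"
    then have ij: "i < n" "j < n" using c by auto
    have LJ: "Lo * gen_diag n s \<sigma> \<in> carrier_mat n n" using c by simp
    have eq: "(Lo * gen_diag n s \<sigma> * Up) $$ (i, j) =
       (\<Sum>k<n. Lo $$ (i, k) * (if k < s then 1 else if k = s then \<sigma> else 0) * Up $$ (k, j))"
      unfolding mult_mat_index[OF LJ c(2) ij]
      by (rule sum.cong) (use ij gen_diag_mult_index[OF c(1)] in auto)
    show "L $$ (i, j) = (Lo * gen_diag n s \<sigma> * Up) $$ (i, j)"
    proof (cases "i = s")
      case False
      have "(\<Sum>k<n. Lo $$ (i, k) * (if k < s then 1 else if k = s then \<sigma> else 0) * Up $$ (k, j)) =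
        (\<Sum>k<n. if k = i then (if i < s then Up $$ (i, j) else 0) else 0)"
        by (rule sum.cong) (use False ij in \<open>auto simp: Lo_def\<close>)
      also have "\<dots> = L $$ (i, j)"
        using False ij by (auto simp: Up_def L_def)
      finally show ?thesis using eq by simp
    next
      case True
      have "(\<Sum>k<n. Lo $$ (i, k) * (if k < s then 1 else if k = s then \<sigma> else 0) * Up $$ (k, j)) =
        (\<Sum>k<Suc s. Lo $$ (i, k) * (if k < s then 1 else if k = s then \<sigma> else 0) * Up $$ (k, j))"
        by (rule sum.mono_neutral_right) (use m in auto)
      also have "\<dots> = (\<Sum>k<s. u k * Up $$ (k, j)) + \<sigma> * Up $$ (s, j)"
        using True ij m by (simp add: Lo_def)
      also have "\<dots> = L $$ (i, j)"
      proof -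
        consider "j < s" | "j = s" | "j > s" by linarith
        then show ?thesis
        proof cases
          case 1
          have "(\<Sum>k<s. u k * Up $$ (k, j)) = (\<Sum>k<s. (if k = j then u j else 0) - (if k < j then u k * (e ^ (N * (j - k)) * B k j) else 0))"
            by (rule sum.cong) (use 1 ij m in \<open>auto simp: Up_def L_def\<close>)
          also have "\<dots> = u j - (\<Sum>k<s. if k < j then u k * (e ^ (N * (j - k)) * B k j) else 0)"
            using 1 by (simp add: sum_subtractf)
          also have "(\<Sum>k<s. if k < j then u k * (e ^ (N * (j - k)) * B k j) else 0) = (\<Sum>k<j. u k * (e ^ (N * (j - k)) * B k j))"
            by (rule sum.mono_neutral_cong_right) (use 1 in auto)
          also have "\<dots> = (\<Sum>k<j. e ^ (N * (j + 1)) * (x k * B k j))"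
          proof (rule sum.cong[OF refl])
            fix k assume "k \<in> {..<j}"
            then have "N * (j + 1) = N * (k + 1) + N * (j - k)" by (simp flip: distrib_left)
            then show "u k * (e ^ (N * (j - k)) * B k j) = e ^ (N * (j + 1)) * (x k * B k j)"
              by (simp only: u_def power_add mult_ac)
          qed
          also have "u j - \<dots> = (if j = 0 then e ^ N else 0)"
          proof (cases "j = 0")
            case False
            then have "x j = (\<Sum>i<j. x i * B i j)" using rec by simp
            then have "u j = (\<Sum>k<j. e ^ (N * (j + 1)) * (x k * B k j))"
              by (simp only: u_def sum_distrib_left)
            then show ?thesis using False by simp
          qed (simp add: u_def x0)
          finally show ?thesis using 1 True ij m by (simp add: L_def Up_def)
        next
          case 2
          have "(\<Sum>k<s. u k * Up $$ (k, j)) = (\<Sum>k<s. if k < m then - (u k * (e ^ (N * (s - k)) * c k)) else 0)"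
            by (rule sum.cong) (use 2 ij m in \<open>auto simp: Up_def L_def\<close>)
          also have "\<dots> = (\<Sum>k<m. - (u k * (e ^ (N * (s - k)) * c k)))"
            by (rule sum.mono_neutral_cong_right) (use m in auto)
          also have "\<dots> = (\<Sum>k<m. - (e ^ (N * (s + 1)) * (x k * c k)))"
          proof (rule sum.cong[OF refl])
            fix k assume "k \<in> {..<m}"
            then have "N * (s + 1) = N * (k + 1) + N * (s - k)" using m by (simp flip: distrib_left)
            then show "- (u k * (e ^ (N * (s - k)) * c k)) = - (e ^ (N * (s + 1)) * (x k * c k))"
              by (simp only: u_def power_add mult_ac)
          qed
          finally show ?thesis using 2 True ij m by (simp add: L_def Up_def \<sigma>_def sum_negf sum_distrib_left)
        next
          case 3
          have "(\<Sum>k<s. u k * Up $$ (k, j)) = 0"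
            by (rule sum.neutral) (use 3 ij m in \<open>auto simp: Up_def\<close>)
          then show ?thesis using 3 True ij m by (simp add: L_def Up_def)
        qed
      qed
      finally show ?thesis using eq by simp
    qed
  qed (use c in \<open>auto simp: L_def\<close>)
  with c dvd show ?thesis unfolding \<sigma>_def by blast
qed

text \<open>Bookkeeping of orders in \<open>e\<close>: the error of the last factor starts at
  \<open>v + q + 1\<close>, just above the order \<open>v + q\<close> that carries
  \<open>D ^ q\<close>. As \<open>\<nu>\<close> is invertible, all higher terms can be written with
  \<open>\<nu>\<close> in front.\<close>

lemma lowest_term_product:
  fixes e :: "'r::comm_ring_1"
  assumes "\<nu> = \<kappa> * \<upsilon>" "\<nu> * \<nu>' = 1"
  shows "\<exists>g. e ^ a * (1 + \<kappa> * (e * D) ^ q + (e * D) ^ (q + 1) * c1) * (\<upsilon> * e ^ v + e ^ (v + q + 1) * c2) =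
     e ^ a * (\<upsilon> * e ^ v) + e ^ (a + v + q) * \<nu> * (D ^ q + e * g)"
proof -
  define S where "S = \<upsilon> * D ^ (q + 1) * c1 + c2 * (1 + \<kappa> * (e * D) ^ q + (e * D) ^ (q + 1) * c1)"
  have "e ^ (a + v + q) * \<nu> * (D ^ q + e * (\<nu>' * S)) = e ^ (a + v + q) * \<nu> * D ^ q + e ^ (a + v + q + 1) * S"
    using assms(2) by (simp add: algebra_simps) (metis (no_types, lifting) mult.assoc mult.commute mult_1)
  then show ?thesis
    by (intro exI[of _ "\<nu>' * S"]) (simp add: S_def assms(1) algebra_simps power_add power_mult_distrib)
qed

lemma finite_X_vars [simp]: "finite (X_vars m)"
  by (simp add: X_vars_def)

lemma card_X_vars: "card (X_vars m) \<le> m * m"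
  unfolding X_vars_def by (rule order_trans[OF card_image_le]) auto

context refutation
begin

text \<open>\<open>M\<close> is \<open>P * L * Q\<close> with constant \<open>P\<close>,
  \<open>Q\<close> and the bordered matrix \<open>L\<close> of the branching program. Labels enter
  \<open>L\<close> only multiplied by signs and powers of \<epsilon>, so the entries of
  \<open>M\<close> are affine. The program fits into the first \<open>s\<close> rows because its
  number of nodes is less than \<open>r \<le> s + 1\<close>.\<close>

lemma probe_computes_det:
  assumes t: "t \<ge> 1" "t * Suc t * t < r"
  shows "\<exists>M q b \<nu> \<nu>' h g. M \<in> carrier_mat n n \<and> (\<forall>i<n. \<forall>j<n. affine_in (X_vars t) (M $$ (i, j))) \<and>
    (CHAR('a) = 0 \<longrightarrow> q = 1) \<and> (CHAR('a) > 0 \<longrightarrow> (\<exists>j. q = CHAR('a) ^ j)) \<and> \<nu> * \<nu>' = 1 \<and>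
    probe (\<lambda>c. Const (fps_const c) :: (xy_var, 'a fps) mpoly) C M =
      Const h + Const (fps_X ^ b * \<nu>) * (det (X_mat t) ^ q + Const fps_X * g)"
proof -
  let ?\<phi> = "\<lambda>c. Const (fps_const c) :: (xy_var, 'a fps) mpoly"
  define e where "e = (Const fps_X :: (xy_var, 'a fps) mpoly)"
  have fc: "comm_ring_hom (fps_const :: 'a \<Rightarrow> 'a fps)" by unfold_locales (auto simp flip: fps_const_add fps_const_mult)
  have \<phi>: "comm_ring_hom ?\<phi>" by (rule comm_ring_hom_compose[OF fc comm_ring_hom_Const])
  obtain s k h where s: "s < n" "r \<le> Suc s" and k: "1 \<le> k" and h: "h \<noteq> 0" and
    fixed: "peval Const (gen_point (X_mat n) (Y_mat n)) h = h" and
    low: "\<And>A B x. A \<in> carrier_mat n n \<Longrightarrow> B \<in> carrier_mat n n \<Longrightarrow> \<exists>c.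
       probe ?\<phi> C (A * gen_diag n s x * B) = x ^ k * (peval ?\<phi> (gen_point A B) h + x * c)"
    using probe_lowest_term[OF \<phi>] by blast
  \<comment> \<open>For suitable exponents \<open>w\<close>, powers of \<epsilon> as entries keep
    \<open>h\<close> nonzero over every field.\<close>
  define P0 where "P0 w = mat n n (\<lambda>(i, j). fps_X ^ w (X i j) :: 'a fps)" for w
  define Q0 where "Q0 w = mat n n (\<lambda>(i, j). fps_X ^ w (Y i j) :: 'a fps)" for w
  obtain w where w: "peval fps_const (gen_point (P0 w) (Q0 w)) h \<noteq> 0"
  proof -
    obtain w where "peval fps_const (\<lambda>v. fps_X ^ w v) h \<noteq> 0"
      using peval_X_powers_nonzero[OF h] by blast
    moreover have "peval fps_const (\<lambda>v. fps_X ^ w v) h = peval fps_const (gen_point (P0 w) (Q0 w)) h"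
    proof -
      interpret fc: comm_ring_hom "fps_const :: 'a \<Rightarrow> 'a fps" by (rule fc)
      have "peval fps_const (\<lambda>v. fps_X ^ w v) h =
        peval fps_const (\<lambda>v. fps_X ^ w v) (peval Const (gen_point (X_mat n) (Y_mat n)) h)"
        using fixed by simp
      also have "\<dots> = peval fps_const (\<lambda>x. peval fps_const (\<lambda>v. fps_X ^ w v) (gen_point (X_mat n) (Y_mat n) x)) h"
        by (subst peval_hom[of "peval fps_const (\<lambda>v. fps_X ^ w v)"]) (simp_all add: fc.comm_ring_hom_peval)
      also have "(\<lambda>x. peval fps_const (\<lambda>v. fps_X ^ w v) (gen_point (X_mat n) (Y_mat n) x)) = gen_point (P0 w) (Q0 w)"
      proof
        fix x
        show "peval fps_const (\<lambda>v. fps_X ^ w v) (gen_point (X_mat n) (Y_mat n) x) = gen_point (P0 w) (Q0 w) x"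
          by (cases x) (auto simp: P0_def Q0_def X_mat_def Y_mat_def)
      qed
      finally show ?thesis .
    qed
    ultimately show thesis using that by metis
  qed
  define h0 where "h0 = peval fps_const (gen_point (P0 w) (Q0 w)) h"
  \<comment> \<open>Splits \<open>h0\<close> into a power of \<epsilon> and a series
    \<open>u\<close> with nonzero constant term.\<close>
  define v where "v = subdegree h0"
  define u where "u = fps_shift v h0"
  have h0_nz: "h0 \<noteq> 0" unfolding h0_def by (rule w)
  have h0: "h0 = u * fps_X ^ v"
    unfolding u_def v_def by (rule subdegree_decompose)
  have u0: "fps_nth u 0 \<noteq> 0"
    unfolding u_def v_def fps_shift_nth add_0 by (rule nth_subdegree_nonzero[OF h0_nz])
  obtain q k' where k': "k' \<noteq> 0" and q: "CHAR('a) = 0 \<longrightarrow> q = 1" "CHAR('a) > 0 \<longrightarrow> (\<exists>j. q = CHAR('a) ^ j)"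
    and expand: "\<forall>y. \<exists>c. (1 + y) ^ k = 1 + ?\<phi> k' * y ^ q + y ^ (q + 1) * c"
    using one_plus_power_lowest_term[OF \<phi> k] by (elim exE conjE) (rule that)
  \<comment> \<open>The value of \<open>h\<close> at the perturbed matrices is off by a multiple of
    \<open>e ^ N\<close>, which has to lie above the order \<open>v + q\<close> of the term
    sought.\<close>
  define N where "N = v + q + 1"
  define D where "D = det (X_mat t :: (xy_var, 'a fps) mpoly mat)"
  let ?S = "{p :: (xy_var, 'a fps) mpoly. affine_in (X_vars t) p}"
  have Xt: "X_mat t \<in> carrier_mat t t" by (simp add: X_mat_def)
  have "\<exists>x B c. x 0 = 1 \<and> (\<forall>j\<ge>1. x j = (\<Sum>i<j. x i * B i j)) \<and>
     D = (\<Sum>i<t * Suc t * t. x i * c i) \<and> (\<forall>i j. B i j \<in> ?S) \<and> (\<forall>i. c i \<in> ?S)"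
    unfolding D_def
    by (rule det_algebraic_branching_program[OF Xt t(1)])
      (auto simp: affine_in_0_1 X_mat_def X_vars_def intro!: affine_in_diff affine_in_Var)
  then obtain x B c where x0: "x 0 = 1" and rec: "\<And>j. j \<ge> 1 \<Longrightarrow> x j = (\<Sum>i<j. x i * B i j)" and
    D: "D = (\<Sum>i<t * Suc t * t. x i * c i)" and B: "\<And>i j. affine_in (X_vars t) (B i j)" and
    c: "\<And>i. affine_in (X_vars t) (c i)"
    by auto
  define m where "m = t * Suc t * t"
  \<comment> \<open>One less than the exponent of the path sum, so that the corner entry
    \<open>e ^ a\<close> makes the Schur complement \<open>e ^ a * (1 + e * D)\<close>.\<close>
  define a where "a = N * (s + 1) - 1"
  have m: "m \<le> s" "m \<ge> 1" using t s by (auto simp: m_def Suc_le_eq)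
  define L where "L = mat n n (\<lambda>(i, j).
      if i < s \<and> j < s then (if i = j then 1 else 0) - (if i < j then e ^ (N * (j - i)) * B i j else 0)
      else if i < s \<and> j = s then (if i < m then - (e ^ (N * (s - i)) * c i) else 0)
      else if i = s \<and> j < s then (if j = 0 then e ^ N else 0)
      else if i = s \<and> j = s then e ^ a else 0)"
  have ae: "e ^ (N * (s + 1)) = e ^ a * e" by (simp add: a_def N_def flip: power_Suc2)
  obtain Lo Up where LU: "Lo \<in> carrier_mat n n" "Up \<in> carrier_mat n n"
     and LUd: "\<And>i j. i < n \<Longrightarrow> j < n \<Longrightarrow> e ^ N dvd Lo $$ (i, j) - 1\<^sub>m n $$ (i, j)"
       "\<And>i j. i < n \<Longrightarrow> j < n \<Longrightarrow> e ^ N dvd Up $$ (i, j) - 1\<^sub>m n $$ (i, j)"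
     and "L = Lo * gen_diag n s (e ^ a + e ^ (N * (s + 1)) * (\<Sum>i<m. x i * c i)) * Up"
    using bordered_factorization[OF x0 rec m(1) s(1), of e N c "e ^ a", folded L_def] by blast
  then have L: "L = Lo * gen_diag n s (e ^ a * (1 + e * D)) * Up"
    unfolding ae D m_def by (simp add: algebra_simps)
  define P where "P = mat n n (\<lambda>(i, j). Const (fps_X ^ w (X i j)) :: (xy_var, 'a fps) mpoly)"
  define Q where "Q = mat n n (\<lambda>(i, j). Const (fps_X ^ w (Y i j)) :: (xy_var, 'a fps) mpoly)"
  have PQ: "P \<in> carrier_mat n n" "Q \<in> carrier_mat n n" by (auto simp: P_def Q_def)
  define M where "M = P * L * Q"
  have Lc: "L \<in> carrier_mat n n" by (simp add: L_def)
  have PLc: "P * L \<in> carrier_mat n n" using PQ Lc by simp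
  have M: "M \<in> carrier_mat n n" unfolding M_def using PLc PQ by simp
  have affine: "affine_in (X_vars t) (M $$ (i, j))" if ij: "i < n" "j < n" for i j
  proof -
    have epow: "e ^ l = Const (fps_X ^ l)" for l by (simp add: e_def Const_simps)
    have Laff: "affine_in (X_vars t) (L $$ (i, j))" if "i < n" "j < n" for i j
      using that B c unfolding L_def epow
      by (auto intro!: affine_in_diff affine_in_uminus affine_in_Const_mult simp: affine_in_0_1 affine_in_Const)
    have PL: "affine_in (X_vars t) ((P * L) $$ (i, j))" if "i < n" "j < n" for i j
      using that Laff unfolding mult_mat_index[OF PQ(1) Lc that]
      by (auto intro!: affine_in_sum affine_in_Const_mult simp: P_def)
    show ?thesis
      unfolding M_def mult_mat_index[OF PLc PQ(2) ij]
      using ij PL by (auto intro!: affine_in_sum affine_in_mult_Const simp: Q_def)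
  qed
  define A' where "A' = P * Lo"
  define B' where "B' = Up * Q"
  have A'B': "A' \<in> carrier_mat n n" "B' \<in> carrier_mat n n" using PQ LU by (auto simp: A'_def B'_def)
  define \<sigma> where "\<sigma> = e ^ a * (1 + e * D)"
  have M': "M = A' * gen_diag n s \<sigma> * B'"
  proof -
    let ?J = "gen_diag n s \<sigma>"
    have J: "?J \<in> carrier_mat n n" by simp
    have LJ: "Lo * ?J \<in> carrier_mat n n" using LU by simp
    have PLJ: "P * (Lo * ?J) \<in> carrier_mat n n" using PQ LJ by simp
    have "P * (Lo * ?J * Up) * Q = P * (Lo * ?J) * Up * Q"
      by (simp only: assoc_mult_mat[OF PQ(1) LJ LU(2)])
    also have "\<dots> = P * (Lo * ?J) * (Up * Q)"
      by (rule assoc_mult_mat[OF PLJ LU(2) PQ(2)])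
    also have "P * (Lo * ?J) = P * Lo * ?J"
      by (rule assoc_mult_mat[OF PQ(1) LU(1) J, symmetric])
    finally show ?thesis by (simp add: M_def L A'_def B'_def \<sigma>_def)
  qed
  obtain c0 where c0: "probe ?\<phi> C M = \<sigma> ^ k * (peval ?\<phi> (gen_point A' B') h + \<sigma> * c0)"
    using low[OF A'B'] M' by blast
  have "e ^ N dvd peval ?\<phi> (gen_point A' B') h - peval ?\<phi> (gen_point P Q) h"
  proof -
    have dA: "e ^ N dvd A' $$ (i, j) - P $$ (i, j)" if ij: "i < n" "j < n" for i j
    proof -
      have "P $$ (i, j) = (P * 1\<^sub>m n) $$ (i, j)" using PQ by simp
      then have "A' $$ (i, j) - P $$ (i, j) = (\<Sum>l<n. P $$ (i, l) * Lo $$ (l, j)) - (\<Sum>l<n. P $$ (i, l) * 1\<^sub>m n $$ (l, j))"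
        by (simp only: A'_def mult_mat_index[OF PQ(1) LU(1) ij] mult_mat_index[OF PQ(1) one_carrier_mat ij])
      also have "\<dots> = (\<Sum>l<n. P $$ (i, l) * (Lo $$ (l, j) - 1\<^sub>m n $$ (l, j)))"
        by (simp only: right_diff_distrib sum_subtractf)
      also have "e ^ N dvd \<dots>" using LUd ij by (intro dvd_sum dvd_mult) auto
      finally show ?thesis .
    qed
    have dB: "e ^ N dvd B' $$ (i, j) - Q $$ (i, j)" if ij: "i < n" "j < n" for i j
    proof -
      have "Q $$ (i, j) = (1\<^sub>m n * Q) $$ (i, j)" using PQ by simp
      then have "B' $$ (i, j) - Q $$ (i, j) = (\<Sum>l<n. Up $$ (i, l) * Q $$ (l, j)) - (\<Sum>l<n. 1\<^sub>m n $$ (i, l) * Q $$ (l, j))"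
        by (simp only: B'_def mult_mat_index[OF LU(2) PQ(2) ij] mult_mat_index[OF one_carrier_mat PQ(2) ij])
      also have "\<dots> = (\<Sum>l<n. (Up $$ (i, l) - 1\<^sub>m n $$ (i, l)) * Q $$ (l, j))"
        by (simp only: left_diff_distrib sum_subtractf)
      also have "e ^ N dvd \<dots>" using LUd ij by (intro dvd_sum dvd_mult2) auto
      finally show ?thesis .
    qed
    show ?thesis
    proof (rule dvd_peval_diff)
      fix x
      show "e ^ N dvd gen_point A' B' x - gen_point P Q x"
        by (cases x) (use A'B' PQ dA dB in auto)
    qed
  qed
  moreover have "peval ?\<phi> (gen_point P Q) h = Const h0"
  proof -
    have "Const h0 = peval ?\<phi> (\<lambda>x. Const (gen_point (P0 w) (Q0 w) x)) h"
      unfolding h0_def by (rule peval_hom[OF comm_ring_hom_Const])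
    also have "(\<lambda>x. Const (gen_point (P0 w) (Q0 w) x)) = gen_point P Q"
    proof
      fix x
      show "Const (gen_point (P0 w) (Q0 w) x) = gen_point P Q x"
        by (cases x) (auto simp: P0_def Q0_def P_def Q_def Const_simps)
    qed
    finally show ?thesis ..
  qed
  ultimately obtain c1 where "peval ?\<phi> (gen_point A' B') h - Const h0 = e ^ N * c1" by (auto elim: dvdE)
  then have c1: "peval ?\<phi> (gen_point A' B') h = Const h0 + e ^ N * c1" by (simp add: algebra_simps)
  \<comment> \<open>Makes \<open>\<sigma>\<close> divisible by \<open>e ^ N\<close>, so that the
    remainder \<open>\<sigma> * c0\<close> joins the error of order \<open>N\<close>. This rests on
    \<open>s \<ge> 1\<close>.\<close>
  have "N \<le> a"
  proof -
    have "1 \<le> N" "1 \<le> s" using m by (auto simp: N_def)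
    then have "1 * 1 \<le> N * s" by (intro mult_le_mono)
    moreover have "N * (s + 1) = N * s + N" by simp
    ultimately show ?thesis unfolding a_def by linarith
  qed
  then have "e ^ N dvd \<sigma>" unfolding \<sigma>_def by (intro dvd_mult2 le_imp_power_dvd)
  then obtain c2 where c2: "\<sigma> = e ^ N * c2" by (rule dvdE)
  define c3 where "c3 = c1 + c2 * c0"
  have bracket: "peval ?\<phi> (gen_point A' B') h + \<sigma> * c0 = Const u * e ^ v + e ^ (v + q + 1) * c3"
    unfolding c1 h0 N_def[symmetric] c3_def
    by (subst c2) (simp add: Const_simps e_def algebra_simps)
  obtain c4 where c4: "(1 + e * D) ^ k = 1 + ?\<phi> k' * (e * D) ^ q + (e * D) ^ (q + 1) * c4"
    using expand by blast
  define \<nu> where "\<nu> = fps_const k' * u"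
  have "fps_nth \<nu> 0 \<noteq> 0" using u0 k' by (simp add: \<nu>_def)
  then have \<nu>: "\<nu> * inverse \<nu> = 1" by (metis inverse_mult_eq_1 mult.commute)
  obtain g where g: "(e ^ (a * k)) * (1 + ?\<phi> k' * (e * D) ^ q + (e * D) ^ (q + 1) * c4) * (Const u * e ^ v + e ^ (v + q + 1) * c3) =
     e ^ (a * k) * (Const u * e ^ v) + e ^ (a * k + v + q) * Const \<nu> * (D ^ q + e * g)"
    using lowest_term_product[of "Const \<nu>" "?\<phi> k'" "Const u" "Const (inverse \<nu>)" e "a * k" D q c4 v c3] \<nu>
    by (auto simp: \<nu>_def simp flip: Const_simps)
  have "probe ?\<phi> C M = e ^ (a * k) * (Const u * e ^ v) + e ^ (a * k + v + q) * Const \<nu> * (D ^ q + e * g)"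
    unfolding c0 bracket g[symmetric] unfolding \<sigma>_def power_mult_distrib c4 power_mult ..
  also have "\<dots> = Const (fps_X ^ (a * k) * (u * fps_X ^ v)) + Const (fps_X ^ (a * k + v + q) * \<nu>) * (D ^ q + Const fps_X * g)"
    by (simp add: e_def Const_simps)
  finally have result: "probe ?\<phi> C M =
    Const (fps_X ^ (a * k) * (u * fps_X ^ v)) + Const (fps_X ^ (a * k + v + q) * \<nu>) * (D ^ q + Const fps_X * g)" .
  have affine': "\<forall>i<n. \<forall>j<n. affine_in (X_vars t) (M $$ (i, j))"
    using affine by simp
  show ?thesis unfolding D_def[symmetric]
    by (intro exI[of _ M] exI[of _ q] exI[of _ "a * k + v + q"] exI[of _ \<nu>] exI[of _ "inverse \<nu>"]
        exI[of _ "fps_X ^ (a * k) * (u * fps_X ^ v)"] exI[of _ g] conjI; fact)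
qed

end

section \<open>The circuit lower bound\<close>

lemma peval_pm_map:
  assumes "comm_ring_hom \<phi>" "comm_ring_hom \<psi>"
  shows "peval \<phi> s (Poly_Mapping.map \<psi> p) = peval (\<lambda>c. \<phi> (\<psi> c)) s p"
proof -
  interpret \<phi>: comm_ring_hom \<phi> by fact
  show ?thesis
    unfolding pm_map_eq_peval[OF assms(2)]
    by (subst peval_hom[of "peval \<phi> s"]) (simp_all add: \<phi>.comm_ring_hom_peval)
qed

lemma pm_map_Const_Var:
  assumes "comm_ring_hom \<psi>"
  shows "Poly_Mapping.map \<psi> (Const c) = Const (\<psi> c)" "Poly_Mapping.map \<psi> (Var v) = Var v"
proof -
  interpret comm_ring_hom \<psi> by fact
  show "Poly_Mapping.map \<psi> (Const c) = Const (\<psi> c)" "Poly_Mapping.map \<psi> (Var v) = Var v"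
    by (simp_all add: Const_def Var_def)
qed

lemma pm_map_det_X_mat:
  assumes "comm_ring_hom \<psi>"
  shows "Poly_Mapping.map \<psi> (det (X_mat t) ^ q) = det (X_mat t) ^ q"
proof -
  interpret m: comm_ring_hom "Poly_Mapping.map \<psi> :: (xy_var, _) mpoly \<Rightarrow> _"
    by (rule comm_ring_hom_pm_map[OF assms])
  have "map_mat (Poly_Mapping.map \<psi>) (X_mat t) = X_mat t"
    by (rule eq_matI) (auto simp: X_mat_def pm_map_Const_Var[OF assms])
  then show ?thesis by (simp add: m.hom_power flip: m.hom_det)
qed

lemma affine_in_pm_map:
  fixes p :: "('v, 'c::comm_ring_1) mpoly"
  assumes "comm_ring_hom \<psi>" "affine_in A p"
  shows "affine_in A (Poly_Mapping.map \<psi> p)"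
proof -
  interpret m: comm_ring_hom "Poly_Mapping.map \<psi> :: ('v, 'c) mpoly \<Rightarrow> _"
    by (rule comm_ring_hom_pm_map[OF assms(1)])
  obtain a0 a where p: "p = Const a0 + (\<Sum>v\<in>A. Const (a v) * Var v)"
    using assms(2) unfolding affine_in_def by blast
  have "Poly_Mapping.map \<psi> p = Const (\<psi> a0) + (\<Sum>v\<in>A. Const (\<psi> (a v)) * Var v)"
    by (simp add: p m.hom_add m.hom_sum m.hom_mult pm_map_Const_Var[OF assms(1)])
  then show ?thesis unfolding affine_in_def by (intro exI)
qed

lemma one_gate_affine:
  assumes "finite A" "affine_in A p" "computed \<Phi> d 1" "\<And>v. v \<in> A \<Longrightarrow> computed \<Phi> d (Var v)" "card A \<le> c"
  shows "one_gate A' \<Phi> d (Suc c) p"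
proof -
  obtain a0 a where p: "p = Const a0 + (\<Sum>v\<in>A. Const (a v) * Var v)"
    using assms(2) unfolding affine_in_def by blast
  \<comment> \<open>\<open>None\<close> indexes the constant term, a wire from a gate of value 1;
    hence the bound \<open>Suc c\<close>.\<close>
  let ?I = "insert None (Some ` A)"
  have "one_gate A' \<Phi> d (Suc c) (\<Sum>i\<in>?I. Const (case i of None \<Rightarrow> a0 | Some v \<Rightarrow> a v) * (case i of None \<Rightarrow> 1 | Some v \<Rightarrow> Var v))"
    by (rule one_gate_sum) (use assms in \<open>auto simp: card_image\<close>)
  also have "(\<Sum>i\<in>?I. Const (case i of None \<Rightarrow> a0 | Some v \<Rightarrow> a v) * (case i of None \<Rightarrow> 1 | Some v \<Rightarrow> Var v)) = p"
    using assms(1) by (subst sum.insert) (auto simp: p sum.reindex)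
  finally show ?thesis .
qed

text \<open>Built in layers: constants and variables, the \<open>n * n\<close> affine entries with
  at most \<open>t * t + 1\<close> wires each, then three batches with two wires per entry, of which
  only the squares multiply. The placeholders of the determinantal equations are 0, so the cost does
  not grow with the number of condenser matrices.\<close>

lemma probe_circuit:
  fixes M :: "(xy_var, 'c::comm_ring_1) mpoly mat" and \<E> :: "'a mat set"
  assumes M: "\<And>i j. i < n \<Longrightarrow> j < n \<Longrightarrow> affine_in (X_vars t) (M $$ (i, j))"
  shows "\<exists>\<Gamma>. well_formed (X_vars t) \<Gamma> \<and> circuit_size \<Gamma> \<le> (t * t + 7) * (n * n) \<and> computed \<Gamma> 1 1 \<and>
    (\<forall>v\<in>ips_vars (X_vars n \<union> Y_vars n) (sys_eqns n \<E>). computed \<Gamma> 1 (probe_point M v))"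
proof -
  let ?I = "{..<n} \<times> {..<n}" and ?A = "X_vars t"
  have card: "c * card (f ` ?I) \<le> c * (n * n)" for f :: "nat \<times> nat \<Rightarrow> (xy_var, 'c) mpoly" and c
    using card_image_le[of ?I f] by simp
  define T0 :: "(xy_var, 'c) mpoly set" where "T0 = insert 0 (insert 1 (Var ` ?A))"
  define T1 where "T1 = (\<lambda>(i, j). M $$ (i, j)) ` ?I"
  define T2 where "T2 = (\<lambda>(i, j). M $$ (i, j) - (if i = j then 1 else 0)) ` ?I"
  define T3 where "T3 = (\<lambda>(i, j). M $$ (i, j) * M $$ (i, j)) ` ?I"
  define T4 where "T4 = (\<lambda>(i, j). M $$ (i, j) * M $$ (i, j) - M $$ (i, j)) ` ?I"
  have fin: "finite T0" "finite T1" "finite T2" "finite T3" "finite T4"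
    by (auto simp: T0_def T1_def T2_def T3_def T4_def)
  have "one_gate ?A [] 0 0 p" if "p \<in> T0" for p
    using that one_gate_Const[of ?A "[]" 0 0 0] one_gate_Const[of ?A "[]" 0 0 1]
    by (auto simp: T0_def Const_simps intro: one_gate_Var)
  from extend_circuit[OF fin(1) well_formed_Nil this]
  obtain \<Gamma>0 where \<Gamma>0: "well_formed ?A \<Gamma>0" "circuit_size \<Gamma>0 \<le> 0" "\<forall>p\<in>T0. computed \<Gamma>0 0 p"
    by auto
  then have base: "computed \<Gamma>0 0 0" "computed \<Gamma>0 0 1" "\<And>v. v \<in> ?A \<Longrightarrow> computed \<Gamma>0 0 (Var v)"
    by (auto simp: T0_def)
  have "one_gate ?A \<Gamma>0 0 (Suc (t * t)) p" if "p \<in> T1" for p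
    using that M card_X_vars by (auto simp: T1_def intro!: one_gate_affine[of ?A] base)
  from extend_circuit[OF fin(2) \<Gamma>0(1) this]
  obtain \<Gamma>1 where \<Gamma>1: "well_formed ?A (\<Gamma>0 @ \<Gamma>1)" "circuit_size \<Gamma>1 \<le> Suc (t * t) * card T1" "\<forall>p\<in>T1. computed (\<Gamma>0 @ \<Gamma>1) 0 p"
    by blast
  define \<Delta>1 where "\<Delta>1 = \<Gamma>0 @ \<Gamma>1"
  have c1: "computed \<Delta>1 0 (M $$ (i, j))" if "i < n" "j < n" for i j
    using \<Gamma>1(3) that by (force simp: T1_def \<Delta>1_def)
  have "computed \<Delta>1 0 (if i = j then 1 else 0)" for i j :: nat
    using base computed_append by (auto simp: \<Delta>1_def)
  then have "one_gate ?A \<Delta>1 0 2 p" if "p \<in> T2" for p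
    using that c1 by (auto simp only: T2_def intro!: one_gate_diff)
  from extend_circuit[OF fin(3) \<Gamma>1(1)[folded \<Delta>1_def] this]
  obtain \<Gamma>2 where \<Gamma>2: "well_formed ?A (\<Delta>1 @ \<Gamma>2)" "circuit_size \<Gamma>2 \<le> 2 * card T2" "\<forall>p\<in>T2. computed (\<Delta>1 @ \<Gamma>2) 0 p"
    by blast
  define \<Delta>2 where "\<Delta>2 = \<Delta>1 @ \<Gamma>2"
  have c2: "computed \<Delta>2 0 (M $$ (i, j))" if "i < n" "j < n" for i j
    using c1[OF that] computed_append by (auto simp: \<Delta>2_def)
  then have "one_gate ?A \<Delta>2 1 2 p" if "p \<in> T3" for p
    using that by (auto simp: T3_def intro!: one_gate_mult[where d = 0, simplified])
  from extend_circuit[OF fin(4) \<Gamma>2(1)[folded \<Delta>2_def] this]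
  obtain \<Gamma>3 where \<Gamma>3: "well_formed ?A (\<Delta>2 @ \<Gamma>3)" "circuit_size \<Gamma>3 \<le> 2 * card T3" "\<forall>p\<in>T3. computed (\<Delta>2 @ \<Gamma>3) 1 p"
    by blast
  define \<Delta>3 where "\<Delta>3 = \<Delta>2 @ \<Gamma>3"
  have c3: "computed \<Delta>3 1 (M $$ (i, j))" "computed \<Delta>3 1 (M $$ (i, j) * M $$ (i, j))" if "i < n" "j < n" for i j
  proof -
    show "computed \<Delta>3 1 (M $$ (i, j))"
      unfolding \<Delta>3_def by (rule computed_append, rule computed_mono[OF c2[OF that]]) simp
    show "computed \<Delta>3 1 (M $$ (i, j) * M $$ (i, j))"
      using \<Gamma>3(3) that by (force simp: T3_def \<Delta>3_def)
  qed
  then have "one_gate ?A \<Delta>3 1 2 p" if "p \<in> T4" for p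
    using that by (auto simp: T4_def intro!: one_gate_diff)
  from extend_circuit[OF fin(5) \<Gamma>3(1)[folded \<Delta>3_def] this]
  obtain \<Gamma>4 where \<Gamma>4: "well_formed ?A (\<Delta>3 @ \<Gamma>4)" "circuit_size \<Gamma>4 \<le> 2 * card T4" "\<forall>p\<in>T4. computed (\<Delta>3 @ \<Gamma>4) 1 p"
    by blast
  define \<Gamma> where "\<Gamma> = \<Delta>3 @ \<Gamma>4"
  have up: "computed \<Delta>3 1 p \<Longrightarrow> computed \<Gamma> 1 p" for p unfolding \<Gamma>_def by (rule computed_append)
  have up1: "computed \<Delta>1 0 p \<Longrightarrow> computed \<Gamma> 1 p" for p
    unfolding \<Gamma>_def \<Delta>3_def \<Delta>2_def by (intro computed_append, erule computed_mono) simp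
  have base': "computed \<Gamma> 1 0" "computed \<Gamma> 1 1"
    by (rule up1, unfold \<Delta>1_def, rule computed_append, rule base)+
  have "circuit_size \<Gamma> \<le> Suc (t * t) * (n * n) + 2 * (n * n) + 2 * (n * n) + 2 * (n * n)"
    using \<Gamma>0(2) \<Gamma>1(2) \<Gamma>2(2) \<Gamma>3(2) \<Gamma>4(2)
      card[of "Suc (t * t)" "\<lambda>(i, j). M $$ (i, j)", folded T1_def]
      card[of 2 "\<lambda>(i, j). M $$ (i, j) - (if i = j then 1 else 0)", folded T2_def]
      card[of 2 "\<lambda>(i, j). M $$ (i, j) * M $$ (i, j)", folded T3_def]
      card[of 2 "\<lambda>(i, j). M $$ (i, j) * M $$ (i, j) - M $$ (i, j)", folded T4_def]
    unfolding \<Gamma>_def \<Delta>3_def \<Delta>2_def \<Delta>1_def circuit_size_append by linarith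
  then have size: "circuit_size \<Gamma> \<le> (t * t + 7) * (n * n)"
    by (simp add: algebra_simps)
  have pts: "computed \<Gamma> 1 (M $$ (i, j))" "computed \<Gamma> 1 (M $$ (i, j) - (if i = j then 1 else 0))"
    "computed \<Gamma> 1 (M $$ (i, j) * M $$ (i, j) - M $$ (i, j))" if ij: "i < n" "j < n" for i j
  proof -
    show "computed \<Gamma> 1 (M $$ (i, j))" using up1 c1[OF ij] by blast
    have "computed \<Delta>2 0 (M $$ (i, j) - (if i = j then 1 else 0))"
      unfolding \<Delta>2_def by (rule bspec[OF \<Gamma>2(3)]) (use ij in \<open>auto simp only: T2_def intro!: image_eqI[of _ _ "(i, j)"]\<close>)
    then show "computed \<Gamma> 1 (M $$ (i, j) - (if i = j then 1 else 0))"
      unfolding \<Gamma>_def \<Delta>3_def by (intro computed_append, elim computed_mono) simp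
    show "computed \<Gamma> 1 (M $$ (i, j) * M $$ (i, j) - M $$ (i, j))"
      unfolding \<Gamma>_def by (rule bspec[OF \<Gamma>4(3)]) (use ij in \<open>auto simp only: T4_def intro!: image_eqI[of _ _ "(i, j)"]\<close>)
  qed
  have "computed \<Gamma> 1 (probe_point M v)" if "v \<in> ips_vars (X_vars n \<union> Y_vars n) (sys_eqns n \<E>)" for v
  proof -
    have "computed \<Gamma> 1 (if i = j then 1 else 0)" for i j :: nat using base' by simp
    then show ?thesis
      using that pts base' by (auto simp: ips_vars_def X_vars_def Y_vars_def sys_eqns_def)
  qed
  with \<Gamma>4(1) size base'(2) show ?thesis unfolding \<Gamma>_def by blast
qed

lemma comm_ring_hom_fps_to_fls: "comm_ring_hom (fps_to_fls :: 'a::comm_ring_1 fps \<Rightarrow> 'a fls)"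
  by unfold_locales (simp_all add: fls_times_fps_to_fls)

lemma comm_ring_hom_fls_const: "comm_ring_hom (fls_const :: 'a::comm_ring_1 \<Rightarrow> 'a fls)"
  by unfold_locales (simp_all add: fls_plus_const)

context refutation
begin

text \<open>Feeding the probe point to \<open>\<Phi>\<close> gives \<open>1 - probe\<close> up to
  the error of \<open>\<Phi>\<close>; an affine map then isolates the power of the
  determinant.\<close>

lemma det_circuit:
  assumes t: "t \<ge> 1" "t * Suc t * t < r"
    and \<Phi>: "circuit_on (ips_vars (X_vars n \<union> Y_vars n) (sys_eqns n \<E>)) \<Phi>" "computes_approx \<Phi> C"
  shows "\<exists>q (\<Psi> :: (xy_var, 'a fls) circuit). (CHAR('a) = 0 \<longrightarrow> q = 1) \<and> (CHAR('a) > 0 \<longrightarrow> (\<exists>j. q = CHAR('a) ^ j)) \<and>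
    circuit_on (X_vars t) \<Psi> \<and> computes_approx \<Psi> (det (X_mat t) ^ q) \<and>
    product_depth \<Psi> \<le> product_depth \<Phi> + 1 \<and>
    circuit_size \<Psi> \<le> circuit_size \<Phi> + ((t * t + 7) * (n * n) + 2)"
proof -
  let ?\<phi> = "\<lambda>c. Const (fps_const c) :: (xy_var, 'a fps) mpoly"
  let ?\<iota> = "Poly_Mapping.map fps_to_fls :: (xy_var, 'a fps) mpoly \<Rightarrow> (xy_var, 'a fls) mpoly"
  obtain M q b \<nu> \<nu>' h g where M: "M \<in> carrier_mat n n" and aff: "\<forall>i<n. \<forall>j<n. affine_in (X_vars t) (M $$ (i, j))"
    and q: "CHAR('a) = 0 \<longrightarrow> q = 1" "CHAR('a) > 0 \<longrightarrow> (\<exists>j. q = CHAR('a) ^ j)" and \<nu>: "\<nu> * \<nu>' = 1" and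
    probe: "probe ?\<phi> C M = Const h + Const (fps_X ^ b * \<nu>) * (det (X_mat t) ^ q + Const fps_X * g)"
    using probe_computes_det[OF t] by (elim exE conjE) (rule that)
  obtain g0 :: "(xy_var + 'a eqn, 'a fps) mpoly" where
    g0: "circuit_poly \<Phi> = Poly_Mapping.map fls_const C + Const fls_X * Poly_Mapping.map fps_to_fls g0"
    using \<Phi>(2) unfolding computes_approx_def by blast
  interpret f: comm_ring_hom "fps_to_fls :: 'a fps \<Rightarrow> 'a fls" by (rule comm_ring_hom_fps_to_fls)
  interpret \<iota>: comm_ring_hom ?\<iota> by (rule comm_ring_hom_pm_map[OF comm_ring_hom_fps_to_fls])
  note \<iota>_simps = pm_map_Const_Var[OF comm_ring_hom_fps_to_fls]
  \<comment> \<open>Replaces \<epsilon> by its power \<open>b + 1\<close>. The error of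
    \<open>\<Phi>\<close> becomes a multiple of this power, and a factor \<epsilon> is left after
    division by \<open>\<tau>\<close>, which has order \<open>b\<close>. The coefficients of
    \<open>C\<close> are free of \<epsilon> and stay fixed.\<close>
  define \<kappa> where "\<kappa> = (\<lambda>c :: 'a fls. fls_compose_power c (b + 1))"
  have \<kappa>: "comm_ring_hom \<kappa>"
    unfolding \<kappa>_def by unfold_locales simp_all
  let ?\<kappa>C = "\<lambda>c. Const (\<kappa> c) :: (xy_var, 'a fls) mpoly"
  have \<kappa>C: "comm_ring_hom ?\<kappa>C" by (rule comm_ring_hom_compose[OF \<kappa> comm_ring_hom_Const])
  define s where "s v = ?\<iota> (probe_point M v)" for v :: "xy_var + 'a eqn"
  have "affine_in (X_vars t) (map_mat ?\<iota> M $$ (i, j))" if "i < n" "j < n" for i j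
    using that aff M by (simp add: affine_in_pm_map[OF comm_ring_hom_fps_to_fls])
  from probe_circuit[OF this, where \<E> = \<E>]
  obtain \<Gamma> where \<Gamma>: "well_formed (X_vars t) \<Gamma>" "circuit_size \<Gamma> \<le> (t * t + 7) * (n * n)" "computed \<Gamma> 1 1"
    "\<forall>v\<in>ips_vars (X_vars n \<union> Y_vars n) (sys_eqns n \<E>). computed \<Gamma> 1 (probe_point (map_mat ?\<iota> M) v)"
    by blast
  have s: "computed \<Gamma> 1 (s v)" if v: "v \<in> ips_vars (X_vars n \<union> Y_vars n) (sys_eqns n \<E>)" for v
  proof -
    have "s v = probe_point (map_mat ?\<iota> M) v"
      using v M by (auto simp: s_def ips_vars_def X_vars_def Y_vars_def sys_eqns_def \<iota>.hom_minus \<iota>.hom_mult)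
    then show ?thesis using \<Gamma>(4) v by simp
  qed
  define g1 where "g1 = peval (\<lambda>f. Const (fps_compose f (fps_X ^ (b + 1)))) (probe_point M) g0"
  have eval: "peval ?\<kappa>C s (circuit_poly \<Phi>) =
    ?\<iota> (1 - probe ?\<phi> C M + Const (fps_X ^ (b + 1)) * g1)"
  proof -
    interpret \<kappa>C: comm_ring_hom ?\<kappa>C by (rule \<kappa>C)
    have "peval ?\<kappa>C s (Poly_Mapping.map fls_const C) = peval (\<lambda>c. ?\<iota> (?\<phi> c)) s C"
      unfolding peval_pm_map[OF \<kappa>C comm_ring_hom_fls_const] by (simp add: \<kappa>_def \<iota>_simps)
    also have "\<dots> = ?\<iota> (peval ?\<phi> (probe_point M) C)"
      unfolding s_def by (rule peval_hom[OF \<iota>.comm_ring_hom_axioms, symmetric])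
    finally have 1: "peval ?\<kappa>C s (Poly_Mapping.map fls_const C) = ?\<iota> (1 - probe ?\<phi> C M)"
      by (simp add: probe_def)
    have "peval ?\<kappa>C s (Poly_Mapping.map fps_to_fls g0) =
        peval (\<lambda>f. ?\<iota> (Const (fps_compose f (fps_X ^ (b + 1))))) s g0"
      unfolding peval_pm_map[OF \<kappa>C comm_ring_hom_fps_to_fls]
      by (simp add: \<kappa>_def \<iota>_simps fls_compose_power_fps_to_fls del: power_Suc)
    also have "\<dots> = ?\<iota> g1"
      unfolding s_def g1_def by (rule peval_hom[OF \<iota>.comm_ring_hom_axioms, symmetric])
    finally have 2: "peval ?\<kappa>C s (Poly_Mapping.map fps_to_fls g0) = ?\<iota> g1" .
    have "\<kappa> fls_X = fps_to_fls (fps_X ^ (b + 1))"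
      unfolding \<kappa>_def by (subst fps_X_to_fls[symmetric], subst fls_compose_power_fps_to_fls) simp_all
    then show ?thesis
      unfolding g0 by (simp only: \<kappa>C.peval_add \<kappa>C.peval_mult \<kappa>C.peval_Const 1 2 \<iota>.hom_add \<iota>.hom_mult \<iota>_simps)
  qed
  define \<tau> where "\<tau> = fps_to_fls (fps_X ^ b * \<nu>)"
  have "\<nu> \<noteq> 0" using \<nu> by auto
  then have \<tau>: "\<tau> \<noteq> 0" by (simp add: \<tau>_def)
  define D where "D = (det (X_mat t) ^ q :: (xy_var, 'a fps) mpoly)"
  \<comment> \<open>Up to the error the value is \<open>1 - h - \<tau> * (D + ...)\<close>, so
    multiplying by \<open>- inverse \<tau>\<close> and adding
    \<open>inverse \<tau> * (1 - h)\<close> isolates \<open>D\<close>.\<close>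
  obtain \<Psi> where \<Psi>: "circuit_on (X_vars t) \<Psi>"
     "circuit_poly \<Psi> = Const (- inverse \<tau>) * peval ?\<kappa>C s (circuit_poly \<Phi>) + Const (inverse \<tau> * fps_to_fls (1 - h))"
     "product_depth \<Psi> \<le> product_depth \<Phi> + 1" "circuit_size \<Psi> \<le> circuit_size \<Gamma> + circuit_size \<Phi> + 2"
    using substitute_circuit[where s = s and a = "- inverse \<tau>" and b = "inverse \<tau> * fps_to_fls (1 - h)",
        OF \<Phi>(1) \<kappa> \<Gamma>(1) s \<Gamma>(3)] by blast
  have "circuit_poly \<Psi> = ?\<iota> D + Const fls_X * ?\<iota> (g - Const \<nu>' * g1)"
  proof -
    have inv: "Const (inverse \<tau>) * Const \<tau> = (1 :: (xy_var, 'a fls) mpoly)"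
      using \<tau> by (simp flip: Const_simps)
    have "fps_X ^ (b + 1) = (fps_X ^ b * \<nu>) * (fps_X * \<nu>')"
      using \<nu> by (simp add: algebra_simps)
    then have pow: "Const (fps_to_fls (fps_X ^ (b + 1))) = (Const \<tau> * (Const fls_X * Const (fps_to_fls \<nu>')) :: (xy_var, 'a fls) mpoly)"
      by (simp only: f.hom_mult \<tau>_def Const_simps fps_X_to_fls[symmetric])
    have "circuit_poly \<Psi> = Const (inverse \<tau>) * Const \<tau> * (?\<iota> D + Const fls_X * ?\<iota> g)
       - Const (inverse \<tau>) * Const \<tau> * (Const fls_X * Const (fps_to_fls \<nu>') * ?\<iota> g1)"
      unfolding \<Psi>(2) eval probe D_def[symmetric] \<iota>.hom_add \<iota>.hom_minus \<iota>.hom_mult \<iota>_simps pow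
        \<tau>_def[symmetric]
      by (simp add: Const_simps algebra_simps)
    then show ?thesis
      unfolding inv by (simp add: \<iota>.hom_minus \<iota>.hom_mult \<iota>_simps algebra_simps)
  qed
  moreover have "?\<iota> D = Poly_Mapping.map fls_const (det (X_mat t) ^ q)"
    by (simp add: D_def pm_map_det_X_mat comm_ring_hom_fps_to_fls comm_ring_hom_fls_const)
  ultimately have "computes_approx \<Psi> (det (X_mat t) ^ q)"
    unfolding computes_approx_def by metis
  moreover have "circuit_size \<Psi> \<le> circuit_size \<Phi> + ((t * t + 7) * (n * n) + 2)"
    using \<Psi>(4) \<Gamma>(2) by linarith
  ultimately show ?thesis using q \<Psi>(1,3) by (intro exI[of _ q] exI[of _ \<Psi>] conjI)
qed

end

text \<open>Computes the empty determinant without wires, for the case in which the extracted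
  determinant has size 0.\<close>

lemma unit_circuit:
  "circuit_on A [InConst 1]" "product_depth [InConst 1] = 0" "circuit_size [InConst 1] = 0"
  "computes_approx [InConst 1] (1 :: ('v, 'a::field) mpoly)"
proof -
  show "circuit_on A [InConst 1]" "product_depth [InConst 1] = 0" "circuit_size [InConst 1] = 0"
    by (auto simp: circuit_on_def product_depth_def circuit_size_def)
  interpret comm_ring_hom "Poly_Mapping.map fls_const :: ('v, 'a) mpoly \<Rightarrow> _"
    by (rule comm_ring_hom_pm_map[OF comm_ring_hom_fls_const])
  interpret f: comm_ring_hom "Poly_Mapping.map fps_to_fls :: ('v, 'a fps) mpoly \<Rightarrow> _"
    by (rule comm_ring_hom_pm_map[OF comm_ring_hom_fps_to_fls])
  show "computes_approx [InConst 1] (1 :: ('v, 'a) mpoly)"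
    unfolding computes_approx_def by (rule exI[of _ 0]) (simp add: circuit_poly_def Const_simps)
qed

text \<open>The divisor 4 makes room for all nodes: for \<open>t = g r \<ge> 1\<close>,
  \<open>t ^ 3 + t ^ 2 \<le> 2 * t ^ 3 < 4 * t ^ 3 \<le> r\<close>.\<close>

lemma cube_root_bound:
  defines "g \<equiv> \<lambda>r. nat \<lfloor>(real r / 4) powr (1 / 3)\<rfloor>"
  shows "(\<lambda>r. real (g r)) \<in> \<Omega>(\<lambda>r. real r powr (1 / 3))"
    and "g r \<ge> 1 \<Longrightarrow> g r * Suc (g r) * g r < r"
proof -
  have root: "(2 :: real) = 8 powr (1 / 3)" "(4 :: real) = 64 powr (1 / 3)"
    using powr_powr[of 2 3 "1 / 3"] powr_powr[of 4 3 "1 / 3"] by simp_all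
  \<comment> \<open>From 64 on the cube root is at least 4, so rounding down loses at most a quarter
    of it; of the half guaranteed below, a quarter remains.\<close>
  have "eventually (\<lambda>r::nat. r \<ge> 64) at_top" by (rule eventually_ge_at_top)
  then have "eventually (\<lambda>r. (real r / 4) powr (1 / 3) - 1 \<ge> 1 / 4 * real r powr (1 / 3)) at_top"
  proof eventually_elim
    case (elim r)
    have "real r powr (1 / 3) / 2 = (real r / 8) powr (1 / 3)"
      by (simp add: powr_divide root(1)[symmetric])
    also have "\<dots> \<le> (real r / 4) powr (1 / 3)" by (intro powr_mono2) auto
    finally have "real r powr (1 / 3) / 2 \<le> (real r / 4) powr (1 / 3)" .
    moreover have "4 \<le> real r powr (1 / 3)"
      unfolding root(2) using elim by (intro powr_mono2) auto
    ultimately show ?case by linarith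
  qed
  then have "eventually (\<lambda>r. norm (real (g r)) \<ge> 1 / 4 * norm (real r powr (1 / 3))) at_top"
  proof eventually_elim
    case (elim r)
    have "real (g r) \<ge> (real r / 4) powr (1 / 3) - 1" unfolding g_def by linarith
    with elim show ?case by simp
  qed
  then show "(\<lambda>r. real (g r)) \<in> \<Omega>(\<lambda>r. real r powr (1 / 3))"
    by (intro landau_omega.bigI[of "1 / 4"]) auto
next
  assume g: "g r \<ge> 1"
  have "real (g r) \<le> (real r / 4) powr (1 / 3)" using g unfolding g_def by linarith
  then have "real (g r) ^ 3 \<le> ((real r / 4) powr (1 / 3)) ^ 3" by (intro power_mono) auto
  also have "\<dots> = real r / 4"
    by (cases "r = 0") (simp_all add: powr_powr flip: powr_numeral)
  finally have "real (4 * g r ^ 3) \<le> real r" by simp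
  then have "4 * g r ^ 3 \<le> r" by (simp only: of_nat_le_iff)
  moreover have "g r * Suc (g r) * g r < 4 * g r ^ 3"
  proof -
    have "g r * Suc (g r) * g r = g r ^ 3 + g r ^ 2" by (simp add: power3_eq_cube power2_eq_square algebra_simps)
    moreover have "g r ^ 2 \<le> g r ^ 3" "g r ^ 3 \<ge> 1" using g by (auto intro: power_increasing)
    ultimately show ?thesis by linarith
  qed
  ultimately show "g r * Suc (g r) * g r < r" by linarith
qed

theorem theorem8p3:
  shows "\<exists>(g :: nat \<Rightarrow> nat) (h :: nat \<Rightarrow> real).
    (\<lambda>r. real (g r)) \<in> \<Omega>(\<lambda>r. real r powr (1/3)) \<and>
    h \<in> O(\<lambda>n. real n ^ 4) \<and>
    (\<forall>(n::nat) (r::nat) (\<E> :: 'a::field mat set) (t :: nat \<Rightarrow> nat \<Rightarrow> nat) C.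
       r \<le> n \<longrightarrow>
       finite \<E> \<longrightarrow>
       weak_lossless_rank_condenser n r (r * (n - r)) \<E> \<longrightarrow>
       card \<E> \<ge> 2 * r * (n - r) + 1 \<longrightarrow>
       (CHAR('a) = 0 \<longrightarrow>
          (\<forall>m \<Delta> (\<Phi> :: (xy_var, 'a fls) circuit).
             circuit_on (X_vars m) \<Phi> \<longrightarrow> product_depth \<Phi> \<le> \<Delta> \<longrightarrow>
             computes_approx \<Phi> (det (X_mat m)) \<longrightarrow>
             circuit_size \<Phi> \<ge> t m \<Delta>)) \<longrightarrow>
       (CHAR('a) > 0 \<longrightarrow>
          (\<forall>m \<Delta> k (\<Phi> :: (xy_var, 'a fls) circuit).
             circuit_on (X_vars m) \<Phi> \<longrightarrow> product_depth \<Phi> \<le> \<Delta> \<longrightarrow>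
             computes_approx \<Phi> (det (X_mat m) ^ (CHAR('a) ^ k)) \<longrightarrow>
             circuit_size \<Phi> \<ge> t m \<Delta>)) \<longrightarrow>
       ips_refutation (X_vars n \<union> Y_vars n) (sys_eqns n \<E>) (sys_poly n) C \<longrightarrow>
       (\<forall>\<Delta> (\<Phi> :: (xy_var + 'a eqn, 'a fls) circuit).
          circuit_on (ips_vars (X_vars n \<union> Y_vars n) (sys_eqns n \<E>)) \<Phi> \<longrightarrow>
          product_depth \<Phi> \<le> \<Delta> \<longrightarrow>
          computes_approx \<Phi> C \<longrightarrow>
          real (circuit_size \<Phi>) \<ge> real (t (g r) (\<Delta> + 1)) - h n))"
proof -
  define g where "g r = nat \<lfloor>(real r / 4) powr (1 / 3)\<rfloor>" for r :: nat
  \<comment> \<open>\<open>10 = 1 + 7 + 2\<close>: as \<open>g r \<le> n\<close> and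
    \<open>n \<ge> 1\<close>, the overhead \<open>(g r * g r + 7) * (n * n) + 2\<close> is at most
    \<open>10 * n ^ 4\<close>.\<close>
  define h where "h n = 10 * real n ^ 4" for n :: nat
  have main: "real (t (g r) (\<Delta> + 1)) - h n \<le> real (circuit_size \<Phi>)"
    if rn: "r \<le> n" and cond: "weak_lossless_rank_condenser n r (r * (n - r)) \<E>"
      and char0: "CHAR('a) = 0 \<longrightarrow>
          (\<forall>m \<Delta> (\<Phi> :: (xy_var, 'a fls) circuit).
             circuit_on (X_vars m) \<Phi> \<longrightarrow> product_depth \<Phi> \<le> \<Delta> \<longrightarrow>
             computes_approx \<Phi> (det (X_mat m)) \<longrightarrow>
             circuit_size \<Phi> \<ge> t m \<Delta>)"
      and charp: "CHAR('a) > 0 \<longrightarrow>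
          (\<forall>m \<Delta> k (\<Phi> :: (xy_var, 'a fls) circuit).
             circuit_on (X_vars m) \<Phi> \<longrightarrow> product_depth \<Phi> \<le> \<Delta> \<longrightarrow>
             computes_approx \<Phi> (det (X_mat m) ^ (CHAR('a) ^ k)) \<longrightarrow>
             circuit_size \<Phi> \<ge> t m \<Delta>)"
      and ips: "ips_refutation (X_vars n \<union> Y_vars n) (sys_eqns n \<E>) (sys_poly n) C"
      and \<Phi>: "circuit_on (ips_vars (X_vars n \<union> Y_vars n) (sys_eqns n \<E>)) \<Phi>"
        "product_depth \<Phi> \<le> \<Delta>" "computes_approx \<Phi> C"
    for n r :: nat and \<E> :: "'a mat set" and t C \<Delta> and \<Phi> :: "(xy_var + 'a eqn, 'a fls) circuit"
  proof -
    \<comment> \<open>Treats all characteristics at once: \<open>q\<close> is 1 or a power of the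
      characteristic, as in the two assumed lower bounds.\<close>
    have lower: "t m d \<le> circuit_size \<Psi>"
      if "CHAR('a) = 0 \<longrightarrow> q = 1" "CHAR('a) > 0 \<longrightarrow> (\<exists>j. q = CHAR('a) ^ j)" "circuit_on (X_vars m) \<Psi>"
        "product_depth \<Psi> \<le> d" "computes_approx \<Psi> (det (X_mat m) ^ q)"
      for m d q and \<Psi> :: "(xy_var, 'a fls) circuit"
      using that char0 charp by (cases "CHAR('a) = 0") auto
    show ?thesis
    proof (cases "g r \<ge> 1")
      case True
      then have gr: "g r * Suc (g r) * g r < r" unfolding g_def by (rule cube_root_bound(2))
      interpret refutation n r \<E> C
        by unfold_locales (use rn gr ips cond in \<open>auto simp: weak_lossless_rank_condenser_def\<close>)
      obtain q and \<Psi> :: "(xy_var, 'a fls) circuit" where \<Psi>: "CHAR('a) = 0 \<longrightarrow> q = 1" "CHAR('a) > 0 \<longrightarrow> (\<exists>j. q = CHAR('a) ^ j)"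
        "circuit_on (X_vars (g r)) \<Psi>" "computes_approx \<Psi> (det (X_mat (g r)) ^ q)"
        "product_depth \<Psi> \<le> product_depth \<Phi> + 1"
        "circuit_size \<Psi> \<le> circuit_size \<Phi> + ((g r * g r + 7) * (n * n) + 2)"
        using det_circuit[OF True gr \<Phi>(1,3)] by (elim exE conjE) (rule that)
      have depth: "product_depth \<Psi> \<le> \<Delta> + 1" using \<Psi>(5) \<Phi>(2) by linarith
      have "t (g r) (\<Delta> + 1) \<le> circuit_size \<Psi>" by (rule lower[OF \<Psi>(1-3) depth \<Psi>(4)])
      moreover have "(g r * g r + 7) * (n * n) + 2 \<le> 10 * n ^ 4"
      proof -
        have "g r * 1 * 1 \<le> g r * Suc (g r) * g r" using True by (intro mult_le_mono) auto
        then have "g r \<le> g r * Suc (g r) * g r" by (simp only: mult_1_right)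
        then have "g r \<le> n" "n \<ge> 1" using gr rn by linarith+
        then have gg: "g r * g r \<le> n * n" and nn: "1 \<le> n * n" by (auto intro: mult_le_mono)
        have "g r * g r * (n * n) \<le> n * n * (n * n)" "1 * (n * n) \<le> n * n * (n * n)"
          by (rule mult_le_mono1[OF gg], rule mult_le_mono1[OF nn])
        moreover have "n ^ 4 = n * n * (n * n)" by (simp add: power4_eq_xxxx)
        moreover have "(g r * g r + 7) * (n * n) = g r * g r * (n * n) + 7 * (n * n)" by (rule distrib_right)
        ultimately show ?thesis using nn by linarith
      qed
      ultimately have "t (g r) (\<Delta> + 1) \<le> circuit_size \<Phi> + 10 * n ^ 4" using \<Psi>(6) by linarith
      then have "real (t (g r) (\<Delta> + 1)) \<le> real (circuit_size \<Phi> + 10 * n ^ 4)" by (simp only: of_nat_le_iff)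
      then show ?thesis by (simp add: h_def)
    next
      case False
      then have g0: "g r = 0" by simp
      \<comment> \<open>For small \<open>r\<close>, including 0, the empty determinant is computed
        with size 0 at every depth, which forces \<open>t 0 (\<Delta> + 1) = 0\<close>. In positive
        characteristic the exponent 1 counts as its power 0.\<close>
      have "det (X_mat 0 :: (xy_var, 'a) mpoly mat) = 1" by (simp add: X_mat_def)
      then have "computes_approx ([InConst 1] :: (xy_var, 'a fls) circuit) (det (X_mat 0) ^ 1)"
        using unit_circuit(4) by simp
      moreover have "\<exists>j. 1 = CHAR('a) ^ j" by (rule exI[of _ 0]) simp
      moreover have "product_depth ([InConst 1] :: (xy_var, 'a fls) circuit) \<le> \<Delta> + 1"
        by (simp add: unit_circuit(2))
      ultimately have "t (g r) (\<Delta> + 1) \<le> circuit_size ([InConst 1] :: (xy_var, 'a fls) circuit)"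
        unfolding g0 using unit_circuit(1) by (intro lower[where q = 1]) simp_all
      then have "t (g r) (\<Delta> + 1) = 0" by (simp add: unit_circuit(3))
      moreover have "0 \<le> h n" by (simp add: h_def)
      ultimately show ?thesis by simp
    qed
  qed
  show ?thesis
  proof (rule exI[of _ g], rule exI[of _ h], intro conjI)
    show "(\<lambda>r. real (g r)) \<in> \<Omega>(\<lambda>r. real r powr (1 / 3))"
      unfolding g_def by (rule cube_root_bound(1))
    show "h \<in> O(\<lambda>n. real n ^ 4)"
      by (simp add: h_def[abs_def])
  qed (intro allI impI, rule main, assumption+)
qed

end
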